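(* Let $\mathcal{G}$ be a non-complete decomposable graph. For every perfect order $\mathcal{P}=(C_1,\ldots,C_r)$ of the cliques of $\mathcal{G}$ there exists a perfect DAG version $\mathcal{D}$ of $\mathcal{G}$ such that the family of Type II Wishart distributions $\mathcal{W}_{\mathrm{P}_{\mathcal{G}}}$, with multi-shape parameter $(\alpha,\beta)$ restricted to $B_{\mathcal{P}}$, is a subfamily of the family of DAG Wishart distributions $\pi_{\mathrm{P}_{\mathcal{D}}}$; that is, for every $(\alpha,\beta)\in B_{\mathcal{P}}$ and every $U^E\in\mathrm{Q}_{\mathcal{G}}$ the probability distribution $\mathcal{W}_{\mathrm{P}_{\mathcal{G}}}(\alpha,\beta,U^E)$ on $\mathrm{P}_{\mathcal{G}}=\mathrm{P}_{\mathcal{D}}$ equals $\pi_{\mathrm{P}_{\mathcal{D}}}(\gamma,U)$ for some $\gamma\in\mathbb{R}^p$ and some positive definite $U$.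
   Context: Let $\mathcal{G}=(V,E)$ be a decomposable (chordal) undirected graph, $V=\{1,\ldots,p\}$; all loops are regarded as belonging to $E$. "Clique" means maximal complete vertex set. A perfect order of the cliques is an enumeration $\mathcal{P}=(C_1,\ldots,C_r)$ of all cliques such that, with $H_j=C_1\cup\cdots\cup C_j$, each separator $S_j=H_{j-1}\cap C_j$ ($2\le j\le r$) is contained in some $C_i$, $i<j$. $\nu(S)$ is the multiplicity of $S$ in $(S_2,\ldots,S_r)$, $J(\mathcal{P},S)=\{j:S_j=S\}$, $c_j=|C_j|$, $s_j=|S_j|$. Cones. $\mathrm{P}_{\mathcal{G}}$ is the set of positive definite $p\times p$ matrices $\Omega$ with $\Omega_{ij}=0$ whenever $\{i,j\}\notin E$; $\mathrm{PD}_{\mathcal{G}}=\{\Omega^{-1}:\Omega\in\mathrm{P}_{\mathcal{G}}\}$. $\mathrm{Q}_{\mathcal{G}}$ is the set of symmetric incomplete matrices $(\Gamma_{ij})_{\{i,j\}\in E}$ with $\Gamma_C$ positive definite for each clique $C$. Each $\Sigma^E\in\mathrm{Q}_{\mathcal{G}}$ has a unique completion $\Sigma\in\mathrm{PD}_{\mathcal{G}}$ agreeing with it on $E$; for $\Omega\in\mathrm{P}_{\mathcal{G}}$, $\Omega^{-E}:=(\Omega^{-1})^E$. Type II Wishart. For $\alpha\in\mathbb{R}^r$, $\beta=(\beta_2,\ldots,\beta_r)\in\mathbb{R}^{r-1}$, the Markov ratio is $H_{\mathcal{G}}(\alpha,\beta,\Sigma^E)=\prod_{i=1}^r\det(\Sigma_{C_i})^{\alpha_i}/\prod_{i=2}^r\det(\Sigma_{S_i})^{\beta_i}$.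 Let $\nu_{\mathcal{G}}(d\Omega)=H_{\mathcal{G}}(\tfrac{c+1}{2},\tfrac{s+1}{2},\Omega^{-E})\,d\Omega$ with $c=(c_1,\ldots,c_r)$, $s=(s_2,\ldots,s_r)$, and $d\Omega$ Lebesgue measure on $\mathrm{P}_{\mathcal{G}}$. For $U^E\in\mathrm{Q}_{\mathcal{G}}$ with completion $U$, $$\omega_{\mathrm{P}_{\mathcal{G}}}(\alpha,\beta,U^E,d\Omega)=e^{-\mathrm{tr}(\Omega U)}H_{\mathcal{G}}(\alpha,\beta,\Omega^{-E})\nu_{\mathcal{G}}(d\Omega),$$ and $\mathcal{W}_{\mathrm{P}_{\mathcal{G}}}(\alpha,\beta,U^E)$ is its normalization to a probability measure. It is defined for $(\alpha,\beta)\in\mathcal{B}$, the set of $(\alpha,\beta)$ for which the total mass is finite for every $U^E\in\mathrm{Q}_{\mathcal{G}}$ and the total mass divided by $H_{\mathcal{G}}(\alpha,\beta,U^E)$ does not depend on $U^E$. It is known (Letac–Massam) that $B_{\mathcal{P}}\subseteq\mathcal{B}$, where $B_{\mathcal{P}}$ is the set of $(\alpha,\beta)$ such that: (a) $\sum_{j\in J(\mathcal{P},S)}(\alpha_j+(c_j-s_j)/2)-\nu(S)\beta(S)=0$ for each separator $S\ne S_2$; (b) $-\alpha_j-(c_j-s_j-1)/2>0$ for $j=2,\ldots,r$ and $-\alpha_1-(c_1-s_2-1)/2>0$; (c) $-\alpha_1-(c_1-s_2)/2-\eta_2>(s_2-1)/2$, where $\eta_2=\sum_{j\in J(\mathcal{P},S_2)}(\alpha_j+(c_j-s_2)/2)-\nu(S_2)\beta(S_2)$.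 Here $\nu(S)\beta(S)$ stands for $\sum_{j\in J(\mathcal{P},S)}\beta_j$. DAGs. A DAG version of $\mathcal{G}$ is an acyclic directed graph $\mathcal{D}$ whose underlying undirected graph is $\mathcal{G}$. $\mathrm{pa}(j)=\{i\neq j: i\to j\}$, $pa_j=|\mathrm{pa}(j)|$. $\mathcal{D}$ is perfect if the parents of each vertex are pairwise adjacent. For a perfect DAG version $\mathcal{D}$ of $\mathcal{G}$ one has $\mathrm{P}_{\mathcal{D}}=\mathrm{P}_{\mathcal{G}}$ (where $\mathrm{P}_{\mathcal{D}}$ is the set of inverse covariance matrices of centered nonsingular Gaussian laws satisfying the directed local Markov property for $\mathcal{D}$). DAG Wishart. For $\gamma\in\mathbb{R}^p$ with $\gamma_j<pa_j/2+1$ for all $j$ and $U$ positive definite, $$\pi_{\mathrm{P}_{\mathcal{D}}}(\gamma,U,d\Omega)=z_{\mathcal{D}}(U,\gamma)^{-1}e^{-\mathrm{tr}(\Omega U)}\prod_{j=1}^pD_{jj}^{\gamma_j}\,d\Omega$$ on $\mathrm{P}_{\mathcal{D}}$, where $\Sigma=\Omega^{-1}$, $D_{jj}=\Sigma_{jj}-\Sigma_{j,\mathrm{pa}(j)}(\Sigma_{\mathrm{pa}(j)})^{-1}\Sigma_{\mathrm{pa}(j),j}$ and $z_{\mathcal{D}}(U,\gamma)$ is the normalizing constant (finite exactly when $\gamma_j<pa_j/2+1$ for all $j$). *)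

theory Defs
  imports "HOL-Probability.Probability"
begin

text \<open>
  The vertex set is the finite type \<open>'n\<close>. An undirected graph is given by its set \<open>E\<close> of edges
  \<open>{i, j}\<close>; every loop \<open>{i, i} = {i}\<close> belongs to \<open>E\<close>.
\<close>

definition undirected_graph :: "'n set set \<Rightarrow> bool" where
  "undirected_graph E \<longleftrightarrow> (\<forall>e\<in>E. \<exists>i j. e = {i, j}) \<and> (\<forall>i. {i, i} \<in> E)"

definition chordal :: "'n set set \<Rightarrow> bool" where
  "chordal E \<longleftrightarrow>
     (\<forall>n (v :: nat \<Rightarrow> 'n).
        4 \<le> n \<and> inj_on v {..<n} \<and> (\<forall>i<n. {v i, v (Suc i mod n)} \<in> E) \<longrightarrow>
        (\<exists>i<n. \<exists>j<n. i \<noteq> j \<and> j \<noteq> Suc i mod n \<and> i \<noteq> Suc j mod n \<and> {v i, v j} \<in> E))"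

definition complete_set :: "'n set set \<Rightarrow> 'n set \<Rightarrow> bool" where
  "complete_set E A \<longleftrightarrow> (\<forall>i\<in>A. \<forall>j\<in>A. {i, j} \<in> E)"

definition cliques :: "'n set set \<Rightarrow> 'n set set" where
  "cliques E = {A. complete_set E A \<and> (\<forall>B. complete_set E B \<and> A \<subseteq> B \<longrightarrow> B = A)}"

text \<open>
  An order \<open>C\<^sub>1, \<dots>, C\<^sub>r\<close> of the cliques is a function \<open>C\<close> of which only the values at \<open>1, \<dots>, r\<close>
  are relevant; likewise only \<open>\<alpha> 1, \<dots>, \<alpha> r\<close> and \<open>\<beta> 2, \<dots>, \<beta> r\<close> matter for the shape parameters below.
\<close>

definition separator :: "(nat \<Rightarrow> 'n set) \<Rightarrow> nat \<Rightarrow> 'n set" where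
  "separator C j = (\<Union>i\<in>{1..j - 1}. C i) \<inter> C j"

definition perfect_order :: "'n set set \<Rightarrow> nat \<Rightarrow> (nat \<Rightarrow> 'n set) \<Rightarrow> bool" where
  "perfect_order E r C \<longleftrightarrow>
     bij_betw C {1..r} (cliques E) \<and> (\<forall>j\<in>{2..r}. \<exists>i\<in>{1..<j}. separator C j \<subseteq> C i)"

definition sep_indices :: "nat \<Rightarrow> (nat \<Rightarrow> 'n set) \<Rightarrow> 'n set \<Rightarrow> nat set" where
  "sep_indices r C S = {j\<in>{2..r}. separator C j = S}"

definition pos_def :: "real^'n^'n \<Rightarrow> bool" where
  "pos_def A \<longleftrightarrow> transpose A = A \<and> (\<forall>x. x \<noteq> 0 \<longrightarrow> x \<bullet> (A *v x) > 0)"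

text \<open>
  The principal submatrix \<open>A\<^sub>S\<close> is represented by the block diagonal matrix with blocks \<open>A\<^sub>S\<close> and
  the identity. Its determinant is that of \<open>A\<^sub>S\<close> (which is 1 for empty \<open>S\<close>), it is positive definite
  iff \<open>A\<^sub>S\<close> is, and the \<open>S \<times> S\<close> block of its inverse is the inverse of \<open>A\<^sub>S\<close>.
\<close>

definition principal :: "'n set \<Rightarrow> real^'n^'n \<Rightarrow> real^'n^'n" where
  "principal S A =
     (\<chi> i j. if i \<in> S \<and> j \<in> S then A $ i $ j else if i = j then 1 else 0)"

definition P_graph :: "'n::finite set set \<Rightarrow> (real^'n^'n) set" where
  "P_graph E = {\<Omega>. pos_def \<Omega> \<and> (\<forall>i j. {i, j} \<notin> E \<longrightarrow> \<Omega> $ i $ j = 0)}"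

definition PD_graph :: "'n::finite set set \<Rightarrow> (real^'n^'n) set" where
  "PD_graph E = matrix_inv ` P_graph E"

text \<open>An incomplete matrix is represented by the matrix whose unspecified entries are \<open>0\<close>.\<close>

definition incomplete :: "'n set set \<Rightarrow> real^'n^'n \<Rightarrow> real^'n^'n" where
  "incomplete E A = (\<chi> i j. if {i, j} \<in> E then A $ i $ j else 0)"

definition Q_graph :: "'n::finite set set \<Rightarrow> (real^'n^'n) set" where
  "Q_graph E = {\<Gamma>. transpose \<Gamma> = \<Gamma> \<and> incomplete E \<Gamma> = \<Gamma> \<and>
                    (\<forall>A\<in>cliques E. pos_def (principal A \<Gamma>))}"

definition completion :: "'n::finite set set \<Rightarrow> real^'n^'n \<Rightarrow> real^'n^'n" where
  "completion E \<Gamma> = (THE \<Sigma>. \<Sigma> \<in> PD_graph E \<and> incomplete E \<Sigma> = \<Gamma>)"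

text \<open>
  Lebesgue measure on the space of symmetric matrices vanishing outside \<open>E\<close>, with one coordinate
  for each edge (loops included). It is regarded as a measure on all matrices; the cones below are
  equipped with its restriction.
\<close>

definition sym_lebesgue :: "'n::finite set set \<Rightarrow> (real^'n^'n) measure" where
  "sym_lebesgue E =
     distr (\<Pi>\<^sub>M e\<in>E. lborel) borel (\<lambda>\<omega>. \<chi> i j. if {i, j} \<in> E then \<omega> {i, j} else 0)"

definition normalized :: "'a measure \<Rightarrow> 'a measure" where
  "normalized M = scale_measure (1 / emeasure M (space M)) M"

definition markov_ratio ::
    "nat \<Rightarrow> (nat \<Rightarrow> 'n::finite set) \<Rightarrow> (nat \<Rightarrow> real) \<Rightarrow> (nat \<Rightarrow> real) \<Rightarrow> real^'n^'n \<Rightarrow> real" where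
  "markov_ratio r C \<alpha> \<beta> \<Gamma> =
     (\<Prod>i\<in>{1..r}. det (principal (C i) \<Gamma>) powr \<alpha> i) /
     (\<Prod>i\<in>{2..r}. det (principal (separator C i) \<Gamma>) powr \<beta> i)"

definition nu_graph ::
    "'n::finite set set \<Rightarrow> nat \<Rightarrow> (nat \<Rightarrow> 'n set) \<Rightarrow> (real^'n^'n) measure" where
  "nu_graph E r C =
     density (restrict_space (sym_lebesgue E) (P_graph E))
       (\<lambda>\<Omega>. ennreal (markov_ratio r C
          (\<lambda>j. (real (card (C j)) + 1) / 2) (\<lambda>j. (real (card (separator C j)) + 1) / 2)
          (incomplete E (matrix_inv \<Omega>))))"

definition typeII_unnormalized ::
    "'n::finite set set \<Rightarrow> nat \<Rightarrow> (nat \<Rightarrow> 'n set) \<Rightarrow> (nat \<Rightarrow> real) \<Rightarrow> (nat \<Rightarrow> real) \<Rightarrow>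
     real^'n^'n \<Rightarrow> (real^'n^'n) measure" where
  "typeII_unnormalized E r C \<alpha> \<beta> \<Gamma> =
     density (nu_graph E r C)
       (\<lambda>\<Omega>. ennreal (exp (- trace (\<Omega> ** completion E \<Gamma>)) *
                     markov_ratio r C \<alpha> \<beta> (incomplete E (matrix_inv \<Omega>))))"

definition typeII_wishart ::
    "'n::finite set set \<Rightarrow> nat \<Rightarrow> (nat \<Rightarrow> 'n set) \<Rightarrow> (nat \<Rightarrow> real) \<Rightarrow> (nat \<Rightarrow> real) \<Rightarrow>
     real^'n^'n \<Rightarrow> (real^'n^'n) measure" where
  "typeII_wishart E r C \<alpha> \<beta> \<Gamma> = normalized (typeII_unnormalized E r C \<alpha> \<beta> \<Gamma>)"

definition eta2 ::
    "nat \<Rightarrow> (nat \<Rightarrow> 'n set) \<Rightarrow> (nat \<Rightarrow> real) \<Rightarrow> (nat \<Rightarrow> real) \<Rightarrow> real" where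
  "eta2 r C \<alpha> \<beta> =
     (\<Sum>j\<in>sep_indices r C (separator C 2).
        \<alpha> j + (real (card (C j)) - real (card (separator C 2))) / 2) -
     (\<Sum>j\<in>sep_indices r C (separator C 2). \<beta> j)"

definition B_order ::
    "nat \<Rightarrow> (nat \<Rightarrow> 'n set) \<Rightarrow> ((nat \<Rightarrow> real) \<times> (nat \<Rightarrow> real)) set" where
  "B_order r C = {(\<alpha>, \<beta>).
     (\<forall>S\<in>separator C ` {2..r}. S \<noteq> separator C 2 \<longrightarrow>
        (\<Sum>j\<in>sep_indices r C S.
           \<alpha> j + (real (card (C j)) - real (card (separator C j))) / 2) -
        (\<Sum>j\<in>sep_indices r C S. \<beta> j) = 0) \<and>
     (\<forall>j\<in>{2..r}. - \<alpha> j - (real (card (C j)) - real (card (separator C j)) - 1) / 2 > 0) \<and>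
     - \<alpha> 1 - (real (card (C 1)) - real (card (separator C 2)) - 1) / 2 > 0 \<and>
     - \<alpha> 1 - (real (card (C 1)) - real (card (separator C 2))) / 2 - eta2 r C \<alpha> \<beta>
       > (real (card (separator C 2)) - 1) / 2}"

text \<open>A directed graph is a relation \<open>D\<close>, with \<open>(i, j) \<in> D\<close> for an arrow from \<open>i\<close> to \<open>j\<close>.\<close>

definition skeleton :: "'n rel \<Rightarrow> 'n set set" where
  "skeleton D = {{i, j} | i j. i = j \<or> (i, j) \<in> D}"

definition dag_version :: "'n rel \<Rightarrow> 'n set set \<Rightarrow> bool" where
  "dag_version D E \<longleftrightarrow> acyclic D \<and> skeleton D = E"

definition pa :: "'n rel \<Rightarrow> 'n \<Rightarrow> 'n set" where
  "pa D j = {i. i \<noteq> j \<and> (i, j) \<in> D}"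

definition nondesc :: "'n rel \<Rightarrow> 'n \<Rightarrow> 'n set" where
  "nondesc D j = {i. i \<noteq> j \<and> (j, i) \<notin> D\<^sup>+}"

definition perfect_dag :: "'n rel \<Rightarrow> bool" where
  "perfect_dag D \<longleftrightarrow>
     (\<forall>j. \<forall>i\<in>pa D j. \<forall>k\<in>pa D j. i \<noteq> k \<longrightarrow> (i, k) \<in> D \<or> (k, i) \<in> D)"

definition gaussian_density :: "real^'n^'n \<Rightarrow> real^'n \<Rightarrow> real" where
  "gaussian_density \<Sigma> x =
     exp (- (x \<bullet> (matrix_inv \<Sigma> *v x)) / 2) / sqrt ((2 * pi) ^ CARD('n) * det \<Sigma>)"

text \<open>
  The density of the coordinates in \<open>A\<close>, obtained by integrating out the others; its value depends
  only on \<open>x $ i\<close> for \<open>i \<in> A\<close>.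
\<close>

definition marginal_density ::
    "(real^'n::finite \<Rightarrow> real) \<Rightarrow> 'n set \<Rightarrow> real^'n \<Rightarrow> real" where
  "marginal_density f A x =
     (LINT y|(\<Pi>\<^sub>M i\<in>- A. lborel). f (\<chi> i. if i \<in> A then x $ i else y i))"

text \<open>
  Conditional independence of the coordinates in \<open>A\<close> and \<open>B\<close> given those in \<open>S\<close>, as the
  factorization \<open>f\<^sub>A\<^sub>B\<^sub>S f\<^sub>S = f\<^sub>A\<^sub>S f\<^sub>B\<^sub>S\<close> of the joint density. It is only used for
  Gaussian densities, all of whose marginal densities are continuous and positive; therefore no
  null set has to be excluded.
\<close>

definition cond_indep ::
    "(real^'n::finite \<Rightarrow> real) \<Rightarrow> 'n set \<Rightarrow> 'n set \<Rightarrow> 'n set \<Rightarrow> bool" where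
  "cond_indep f A B S \<longleftrightarrow>
     (\<forall>x. marginal_density f (A \<union> B \<union> S) x * marginal_density f S x =
          marginal_density f (A \<union> S) x * marginal_density f (B \<union> S) x)"

definition directed_local_markov :: "'n::finite rel \<Rightarrow> (real^'n \<Rightarrow> real) \<Rightarrow> bool" where
  "directed_local_markov D f \<longleftrightarrow> (\<forall>j. cond_indep f {j} (nondesc D j - pa D j) (pa D j))"

definition P_dag :: "'n::finite rel \<Rightarrow> (real^'n^'n) set" where
  "P_dag D =
     matrix_inv ` {\<Sigma>. pos_def \<Sigma> \<and> directed_local_markov D (gaussian_density \<Sigma>)}"

text \<open>The conditional variance \<open>D\<^sub>j\<^sub>j\<close> of coordinate \<open>j\<close> given its parents.\<close>

definition cond_var :: "'n::finite rel \<Rightarrow> real^'n^'n \<Rightarrow> 'n \<Rightarrow> real" where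
  "cond_var D \<Sigma> j =
     \<Sigma> $ j $ j -
     (\<Sum>k\<in>pa D j. \<Sum>l\<in>pa D j.
        \<Sigma> $ j $ k * matrix_inv (principal (pa D j) \<Sigma>) $ k $ l * \<Sigma> $ l $ j)"

text \<open>
  The reference measure is Lebesgue measure of the space of symmetric matrices vanishing outside
  the skeleton, which is the appropriate one for perfect \<open>D\<close>.
\<close>

definition dag_wishart ::
    "'n::finite rel \<Rightarrow> real^'n \<Rightarrow> real^'n^'n \<Rightarrow> (real^'n^'n) measure" where
  "dag_wishart D \<gamma> U =
     normalized
       (density (restrict_space (sym_lebesgue (skeleton D)) (P_dag D))
         (\<lambda>\<Omega>. ennreal (exp (- trace (\<Omega> ** U)) *
                       (\<Prod>j\<in>UNIV. cond_var D (matrix_inv \<Omega>) j powr (\<gamma> $ j)))))"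

end

theory Submission
  imports Defs
begin

text \<open>
  The order \<open>C\<^sub>1, \<dots>, C\<^sub>r\<close> dictates an order of the vertices: \<open>S\<^sub>2\<close> comes first, then
  \<open>C\<^sub>1 - S\<^sub>2\<close>, then the residuals \<open>R\<^sub>j = C\<^sub>j - S\<^sub>j\<close> for \<open>j = 2, \<dots>, r\<close>; ties inside these blocks are
  broken by an arbitrary numbering. Orient every edge from the earlier to the later end. Since the
  order of the cliques is perfect, the parents of a vertex in \<open>R\<^sub>j\<close> are \<open>S\<^sub>j\<close> together with its
  predecessors in \<open>R\<^sub>j\<close>, a complete set (\<open>pa_clique_dag\<close>). The chain rule for determinants
  therefore gives \<open>det \<Sigma>\<^sub>C / det \<Sigma>\<^sub>S = \<Prod> D\<^sub>v\<^sub>v\<close>, the product over \<open>v \<in> R\<^sub>j\<close>, for \<open>C = C\<^sub>j\<close>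
  and \<open>S = S\<^sub>j\<close>.

  In the Type II density the Markov ratio has exponents \<open>a\<^sub>j = \<alpha>\<^sub>j + (c\<^sub>j + 1) / 2\<close> and
  \<open>b\<^sub>j = \<beta>\<^sub>j + (s\<^sub>j + 1) / 2\<close>, the halves coming from the reference measure. Written in terms of the
  \<open>D\<^sub>v\<^sub>v\<close>, it leaves over each \<open>det \<Sigma>\<^sub>S\<close> with exponent \<open>\<Sum> (a\<^sub>j - b\<^sub>j)\<close>, the sum over
  \<open>j \<in> J(P, S)\<close>. The first condition of \<open>B_order\<close> says that this exponent vanishes for \<open>S \<noteq> S\<^sub>2\<close>, and for
  \<open>S\<^sub>2\<close> it is \<open>\<eta>\<^sub>2\<close>. Because \<open>S\<^sub>2\<close> is placed first, \<open>det \<Sigma>\<^sub>S\<close> with \<open>S = S\<^sub>2\<close> is itself a product of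
  \<open>D\<^sub>v\<^sub>v\<close>. So the Markov ratio is \<open>\<Prod> D\<^sub>v\<^sub>v\<close> to powers \<open>\<gamma>\<^sub>v\<close> equal to \<open>a\<^sub>1 + \<eta>\<^sub>2\<close> on
  \<open>S\<^sub>2\<close>, to \<open>a\<^sub>1\<close> on \<open>C\<^sub>1 - S\<^sub>2\<close> and to \<open>a\<^sub>j\<close> on \<open>R\<^sub>j\<close> (\<open>markov_ratio_cond_var\<close>), and the other
  conditions give the bounds on \<open>\<gamma>\<close> (\<open>shape_bound\<close>).

  With \<open>U\<close> the completion of \<open>\<Gamma>\<close>, the two unnormalized densities coincide. It remains to see that
  they live on the same cone (\<open>P_dag_eq_P_graph\<close>) and that \<open>\<Gamma>\<close> has exactly one completion, so that
  the completion is positive definite (\<open>completion_in_PD_graph\<close>). Both rest on one observation about a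
  positive definite \<open>\<Sigma>\<close>: coordinate \<open>j\<close> is conditionally independent of its further
  nondescendants given its parents iff the row of \<open>j\<close> in the precision matrix of \<open>\<Sigma>\<close> restricted to
  \<open>j\<close> and its nondescendants vanishes at those nondescendants. Such a row is then determined by the entries
  of \<open>\<Sigma>\<close> on \<open>j\<close> and its parents, and all these rows together yield a triangular factorization of
  \<open>\<Sigma>\<^sup>-\<^sup>1\<close>.
\<close>

section \<open>Precision matrices of principal blocks\<close>

lemma inner_mult_vec_sum:
  fixes A :: "real^'n::finite^'n"
  shows "x \<bullet> (A *v x) = (\<Sum>i\<in>UNIV. \<Sum>j\<in>UNIV. x $ i * A $ i $ j * x $ j)"
  by (simp add: inner_vec_def matrix_vector_mult_def sum_distrib_left mult.assoc)

lemma quad_principal: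
  fixes S :: "real^'n::finite^'n"
  shows "x \<bullet> (principal A S *v x) =
    (\<Sum>i\<in>A. \<Sum>j\<in>A. x $ i * S $ i $ j * x $ j) + (\<Sum>i\<in>-A. (x $ i)\<^sup>2)"
proof -
  have row_in: "(\<Sum>j\<in>UNIV. x $ i * principal A S $ i $ j * x $ j)
      = (\<Sum>j\<in>A. x $ i * S $ i $ j * x $ j)" if "i \<in> A" for i
    using that by (intro sum.mono_neutral_cong_right) (auto simp: principal_def)
  have row_out: "(\<Sum>j\<in>UNIV. x $ i * principal A S $ i $ j * x $ j) = (x $ i)\<^sup>2"
    if "i \<in> -A" for i
  proof -
    have "(\<Sum>j\<in>UNIV. x $ i * principal A S $ i $ j * x $ j)
        = (\<Sum>j\<in>{i}. x $ i * principal A S $ i $ j * x $ j)"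
      using that by (intro sum.mono_neutral_right) (auto simp: principal_def)
    then show ?thesis
      using that by (simp add: principal_def power2_eq_square)
  qed
  have "x \<bullet> (principal A S *v x)
      = (\<Sum>i\<in>A \<union> -A. \<Sum>j\<in>UNIV. x $ i * principal A S $ i $ j * x $ j)"
    by (simp add: inner_mult_vec_sum)
  also have "\<dots> = (\<Sum>i\<in>A. \<Sum>j\<in>UNIV. x $ i * principal A S $ i $ j * x $ j)
      + (\<Sum>i\<in>-A. \<Sum>j\<in>UNIV. x $ i * principal A S $ i $ j * x $ j)"
    by (rule sum.union_disjoint) auto
  finally show ?thesis
    by (simp add: row_in row_out)
qed

lemma pos_def_principal_iff:
  fixes S :: "real^'n::finite^'n"
  shows "pos_def (principal A S) \<longleftrightarrow>
    (\<forall>i\<in>A. \<forall>j\<in>A. S $ i $ j = S $ j $ i) \<and>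
    (\<forall>x. (\<exists>i\<in>A. x $ i \<noteq> 0) \<longrightarrow> 0 < (\<Sum>i\<in>A. \<Sum>j\<in>A. x $ i * S $ i $ j * x $ j))"
    (is "?L \<longleftrightarrow> ?R1 \<and> ?R2")
proof (intro iffI conjI)
  assume L: ?L
  then have "transpose (principal A S) = principal A S" by (simp add: pos_def_def)
  then have sym: "transpose (principal A S) $ i $ j = principal A S $ i $ j" for i j by simp
  show ?R1
  proof (intro ballI)
    fix i j assume "i \<in> A" "j \<in> A"
    then show "S $ i $ j = S $ j $ i"
      using sym[of i j] by (simp add: principal_def transpose_def)
  qed
  show ?R2
  proof (intro allI impI)
    fix x :: "real^'n" assume x: "\<exists>i\<in>A. x $ i \<noteq> 0"
    define y :: "real^'n" where "y = (\<chi> i. if i \<in> A then x $ i else 0)"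
    have "y \<noteq> 0" using x by (auto simp: y_def vec_eq_iff)
    with L have "0 < y \<bullet> (principal A S *v y)" by (simp add: pos_def_def)
    also have "\<dots> = (\<Sum>i\<in>A. \<Sum>j\<in>A. x $ i * S $ i $ j * x $ j)"
      unfolding quad_principal by (simp add: y_def)
    finally show "0 < (\<Sum>i\<in>A. \<Sum>j\<in>A. x $ i * S $ i $ j * x $ j)" .
  qed
next
  assume R: "?R1 \<and> ?R2"
  show ?L
    unfolding pos_def_def
  proof (intro conjI allI impI)
    show "transpose (principal A S) = principal A S"
      using R by (auto simp: principal_def transpose_def vec_eq_iff)
    fix x :: "real^'n" assume "x \<noteq> 0"
    then obtain i where i: "x $ i \<noteq> 0" by (auto simp: vec_eq_iff)
    have sq: "0 \<le> (\<Sum>i\<in>-A. (x $ i)\<^sup>2)" by (simp add: sum_nonneg)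
    show "0 < x \<bullet> (principal A S *v x)"
    proof (cases "\<exists>i\<in>A. x $ i \<noteq> 0")
      case True
      then show ?thesis using R sq unfolding quad_principal by fastforce
    next
      case False
      then have "0 < (\<Sum>i\<in>-A. (x $ i)\<^sup>2)"
        using i by (intro sum_pos2[of _ i]) auto
      with False show ?thesis unfolding quad_principal by simp
    qed
  qed
qed

lemma principal_UNIV [simp]: "principal UNIV S = S"
  by (simp add: principal_def vec_eq_iff)

lemma principal_cong:
  assumes "\<And>i j. i \<in> A \<Longrightarrow> j \<in> A \<Longrightarrow> S $ i $ j = S' $ i $ j"
  shows "principal A S = principal A S'"
  using assms by (simp add: principal_def vec_eq_iff)

text \<open>
  Extend a vector on \<open>A\<close> by zero to a vector on \<open>B\<close>.
\<close>

lemma pos_def_principal_subset: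
  fixes S :: "real^'n::finite^'n"
  assumes "pos_def (principal B S)" and "A \<subseteq> B"
  shows "pos_def (principal A S)"
  unfolding pos_def_principal_iff
proof (intro conjI allI impI)
  have B: "\<forall>i\<in>B. \<forall>j\<in>B. S $ i $ j = S $ j $ i"
    "\<And>x. (\<exists>i\<in>B. x $ i \<noteq> 0) \<Longrightarrow> 0 < (\<Sum>i\<in>B. \<Sum>j\<in>B. x $ i * S $ i $ j * x $ j)"
    using assms(1) by (auto simp: pos_def_principal_iff)
  show "\<forall>i\<in>A. \<forall>j\<in>A. S $ i $ j = S $ j $ i" using B(1) assms(2) by blast
  fix x :: "real^'n" assume x: "\<exists>i\<in>A. x $ i \<noteq> 0"
  define y :: "real^'n" where "y = (\<chi> i. if i \<in> A then x $ i else 0)"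
  have "\<exists>i\<in>B. y $ i \<noteq> 0" using x assms(2) by (auto simp: y_def)
  then have "0 < (\<Sum>i\<in>B. \<Sum>j\<in>B. y $ i * S $ i $ j * y $ j)" by (rule B(2))
  also have "\<dots> = (\<Sum>i\<in>A. \<Sum>j\<in>A. x $ i * S $ i $ j * x $ j)"
    using assms(2)
    by (intro sum.mono_neutral_cong_right sum.neutral ballI) (auto simp: y_def)
  finally show "0 < (\<Sum>i\<in>A. \<Sum>j\<in>A. x $ i * S $ i $ j * x $ j)" .
qed

lemma pos_def_principal:
  fixes S :: "real^'n::finite^'n"
  shows "pos_def S \<Longrightarrow> pos_def (principal A S)"
  using pos_def_principal_subset[of UNIV S A] by simp

lemma pos_def_sym: "pos_def S \<Longrightarrow> S $ i $ j = S $ j $ i"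
  unfolding pos_def_def by (metis transpose_def vec_lambda_beta)

lemma matrix_inv_inverse:
  fixes A :: "real^'n::finite^'n"
  assumes "invertible A"
  shows "A ** matrix_inv A = mat 1" and "matrix_inv A ** A = mat 1"
proof -
  have "\<exists>B. A ** B = mat 1 \<and> B ** A = mat 1" using assms by (simp add: invertible_def)
  then have "A ** matrix_inv A = mat 1 \<and> matrix_inv A ** A = mat 1"
    unfolding matrix_inv_def by (rule someI_ex)
  then show "A ** matrix_inv A = mat 1" and "matrix_inv A ** A = mat 1" by auto
qed

lemma matrix_inv_eqI:
  fixes A B :: "real^'n::finite^'n"
  assumes "A ** B = mat 1"
  shows "matrix_inv A = B"
proof -
  have "invertible A" using assms invertible_right_inverse by blast
  then have "matrix_inv A ** (A ** B) = B"
    by (simp add: matrix_mul_assoc matrix_inv_inverse)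
  then show ?thesis using assms by simp
qed

lemma pos_def_invertible:
  fixes A :: "real^'n::finite^'n"
  assumes "pos_def A"
  shows "invertible A"
proof -
  have "x = 0" if "A *v x = 0" for x
    using assms that unfolding pos_def_def by (metis inner_zero_right less_irrefl)
  then show ?thesis
    by (simp add: invertible_left_inverse matrix_left_invertible_ker)
qed

lemma pos_def_matrix_inv:
  fixes A :: "real^'n::finite^'n"
  assumes "pos_def A"
  shows "pos_def (matrix_inv A)"
  unfolding pos_def_def
proof (intro conjI allI impI)
  note inv = matrix_inv_inverse[OF pos_def_invertible[OF assms]]
  have tA: "transpose A = A" using assms by (simp add: pos_def_def)
  have "A ** transpose (matrix_inv A) = transpose (matrix_inv A ** A)"
    by (simp add: matrix_transpose_mul tA)
  then have "A ** transpose (matrix_inv A) = mat 1" by (simp add: inv transpose_mat)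
  then show "transpose (matrix_inv A) = matrix_inv A" using matrix_inv_eqI by metis
  fix x :: "real^'n" assume "x \<noteq> 0"
  have x: "A *v (matrix_inv A *v x) = x" by (simp add: matrix_vector_mul_assoc inv)
  then have "matrix_inv A *v x \<noteq> 0" using \<open>x \<noteq> 0\<close> by fastforce
  then have "0 < (matrix_inv A *v x) \<bullet> (A *v (matrix_inv A *v x))"
    using assms by (simp add: pos_def_def)
  then show "0 < x \<bullet> (matrix_inv A *v x)" by (simp add: x inner_commute)
qed

lemma matrix_inv_matrix_inv:
  fixes A :: "real^'n::finite^'n"
  shows "invertible A \<Longrightarrow> matrix_inv (matrix_inv A) = A"
  by (simp add: matrix_inv_eqI matrix_inv_inverse)

text \<open>
  The precision matrix of the coordinates in \<open>T\<close>, extended by zero so that matrices belonging to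
  different \<open>T\<close> can be added and compared entrywise.
\<close>

definition precision :: "'n set \<Rightarrow> real^'n::finite^'n \<Rightarrow> real^'n^'n" where
  "precision T S = (\<chi> i j. if i \<in> T \<and> j \<in> T then matrix_inv (principal T S) $ i $ j else 0)"

lemma precision_outside [simp]:
  "i \<notin> T \<Longrightarrow> precision T S $ i $ j = 0" "j \<notin> T \<Longrightarrow> precision T S $ i $ j = 0"
  by (simp_all add: precision_def)

lemma precision_UNIV: "precision UNIV S = matrix_inv S"
  by (simp add: precision_def vec_eq_iff)

lemma precision_cong:
  assumes "\<And>i j. i \<in> T \<Longrightarrow> j \<in> T \<Longrightarrow> S $ i $ j = S' $ i $ j"
  shows "precision T S = precision T S'"
proof -
  have "principal T S = principal T S'" by (rule principal_cong) (rule assms)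
  then show ?thesis unfolding precision_def by (rule arg_cong)
qed

lemma precision_sym:
  assumes "pos_def (principal T S)"
  shows "precision T S $ i $ j = precision T S $ j $ i"
  using pos_def_sym[OF pos_def_matrix_inv[OF assms]] by (auto simp: precision_def)

lemma precision_mult:
  assumes "pos_def (principal T S)" and "i \<in> T" and "j \<in> T"
  shows "(\<Sum>k\<in>T. precision T S $ i $ k * S $ k $ j) = (if i = j then 1 else 0)"
proof -
  have "matrix_inv (principal T S) ** principal T S = mat 1"
    by (rule matrix_inv_inverse[OF pos_def_invertible[OF assms(1)]])
  then have "(\<Sum>k\<in>UNIV. matrix_inv (principal T S) $ i $ k * principal T S $ k $ j)
      = (if i = j then 1 else 0)"
    by (simp add: matrix_matrix_mult_def mat_def vec_eq_iff)
  also have "(\<Sum>k\<in>UNIV. matrix_inv (principal T S) $ i $ k * principal T S $ k $ j)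
      = (\<Sum>k\<in>T. precision T S $ i $ k * S $ k $ j)"
    using assms by (intro sum.mono_neutral_cong_right) (auto simp: precision_def principal_def)
  finally show ?thesis .
qed

lemma mult_precision:
  assumes "pos_def (principal T S)" and "i \<in> T" and "j \<in> T"
  shows "(\<Sum>k\<in>T. S $ i $ k * precision T S $ k $ j) = (if i = j then 1 else 0)"
proof -
  have "(\<Sum>k\<in>T. S $ i $ k * precision T S $ k $ j) = (\<Sum>k\<in>T. precision T S $ j $ k * S $ k $ i)"
  proof (rule sum.cong)
    fix k assume "k \<in> T"
    then have "S $ i $ k = S $ k $ i"
      using assms by (simp add: pos_def_principal_iff)
    then show "S $ i $ k * precision T S $ k $ j = precision T S $ j $ k * S $ k $ i"
      using precision_sym[OF assms(1), of j k] by simp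
  qed simp
  then show ?thesis using precision_mult[OF assms(1,3,2)] by auto
qed

text \<open>
  This is how all identities between precision matrices are obtained below: a row is recognized
  by the linear equations that it solves.
\<close>

lemma precision_row_unique:
  assumes "pos_def (principal T S)" and "i \<in> T" and "k \<in> T"
    and "\<And>j. j \<in> T \<Longrightarrow> (\<Sum>k\<in>T. a k * S $ k $ j) = (if i = j then 1 else 0)"
  shows "a k = precision T S $ i $ k"
proof -
  have "a k = (\<Sum>l\<in>T. a l * (\<Sum>j\<in>T. S $ l $ j * precision T S $ j $ k))"
    using assms(3) by (simp add: mult_precision[OF assms(1)] if_distrib[of "\<lambda>x. _ * x"] cong: if_cong)
  also have "\<dots> = (\<Sum>j\<in>T. (\<Sum>l\<in>T. a l * S $ l $ j) * precision T S $ j $ k)"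
    unfolding sum_distrib_left sum_distrib_right by (subst sum.swap) (simp add: mult.assoc)
  also have "\<dots> = (\<Sum>j\<in>T. (if i = j then 1 else 0) * precision T S $ j $ k)"
    using assms(4) by simp
  also have "\<dots> = (\<Sum>j\<in>T. (if i = j then precision T S $ j $ k else 0))"
    by (intro sum.cong) auto
  also have "\<dots> = precision T S $ i $ k" using assms(2) by simp
  finally show ?thesis .
qed

text \<open>
  For the row \<open>x\<close> of \<open>i\<close>, the quadratic form \<open>x \<bullet> S x\<close> equals the diagonal entry.
\<close>

lemma precision_diag_pos:
  assumes "pos_def (principal T S)" and "i \<in> T"
  shows "0 < precision T S $ i $ i"
proof -
  let ?x = "\<chi> k. precision T S $ i $ k"
  have nz: "\<exists>k\<in>T. ?x $ k \<noteq> 0"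
  proof (rule ccontr)
    assume "\<not> (\<exists>k\<in>T. ?x $ k \<noteq> 0)"
    then have "(\<Sum>k\<in>T. precision T S $ i $ k * S $ k $ i) = 0" by simp
    then show False using precision_mult[OF assms(1,2,2)] by simp
  qed
  have "0 < (\<Sum>k\<in>T. \<Sum>l\<in>T. ?x $ k * S $ k $ l * ?x $ l)"
    using assms(1) nz unfolding pos_def_principal_iff by blast
  also have "\<dots> = (\<Sum>l\<in>T. (\<Sum>k\<in>T. precision T S $ i $ k * S $ k $ l) * precision T S $ i $ l)"
    unfolding sum_distrib_right by (subst sum.swap) simp
  also have "\<dots> = (\<Sum>l\<in>T. if i = l then precision T S $ i $ l else 0)"
    using assms by (intro sum.cong) (auto simp: precision_mult)
  finally show ?thesis using assms(2) by simp
qed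

text \<open>
  Marginalizing out \<open>v\<close> is one step of Gaussian elimination (a Schur complement) on the precision
  matrix: the right-hand side vanishes in row and column \<open>v\<close> and solves the equations that
  characterize the smaller precision matrix.
\<close>

lemma precision_remove:
  assumes pd: "pos_def (principal T S)" and v: "v \<in> T"
  shows "precision (T - {v}) S $ i $ j =
    precision T S $ i $ j - precision T S $ i $ v * precision T S $ v $ j / precision T S $ v $ v"
proof -
  let ?K = "precision T S"
  have pos: "?K $ v $ v > 0" by (rule precision_diag_pos[OF pd v])
  show ?thesis
  proof (cases "i \<in> T - {v} \<and> j \<in> T - {v}")
    case True
    define a where "a k = ?K $ i $ k - ?K $ i $ v * ?K $ v $ k / ?K $ v $ v" for k
    have "a j = precision (T - {v}) S $ i $ j"
    proof (rule precision_row_unique)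
      show "pos_def (principal (T - {v}) S)" by (rule pos_def_principal_subset[OF pd]) auto
      fix l assume l: "l \<in> T - {v}"
      have "(\<Sum>k\<in>T - {v}. a k * S $ k $ l) = (\<Sum>k\<in>T. a k * S $ k $ l)"
        using pos by (intro sum.mono_neutral_left) (auto simp: a_def)
      also have "\<dots> = (\<Sum>k\<in>T. ?K $ i $ k * S $ k $ l)
          - ?K $ i $ v / ?K $ v $ v * (\<Sum>k\<in>T. ?K $ v $ k * S $ k $ l)"
        by (simp add: a_def algebra_simps sum_subtractf sum_distrib_left)
      also have "\<dots> = (if i = l then 1 else 0)"
        using True l v pd by (auto simp: precision_mult)
      finally show "(\<Sum>k\<in>T - {v}. a k * S $ k $ l) = (if i = l then 1 else 0)" .
    qed (use True in auto)
    then show ?thesis by (simp add: a_def)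
  next
    case False
    with pos show ?thesis by (auto simp: precision_def)
  qed
qed

lemma principal_empty [simp]: "principal {} S = mat 1"
  by (simp add: principal_def mat_def vec_eq_iff)

text \<open>
  Cramer's rule twice: replacing column \<open>v\<close> of the larger matrix by a unit vector multiplies the
  determinant by a diagonal entry of the inverse, and the result has the same determinant as the
  smaller matrix.
\<close>

lemma det_principal_remove:
  fixes S :: "real^'n::finite^'n"
  assumes pd: "pos_def (principal (insert v A) S)" and v: "v \<notin> A"
  shows "det (principal A S) =
    precision (insert v A) S $ v $ v * det (principal (insert v A) S)"
proof -
  let ?T = "insert v A"
  let ?P = "principal ?T S" and ?Q = "principal A S"
  define M :: "real^'n^'n" where "M = (\<chi> i j. if j = v then (if i = v then 1 else 0) else ?P $ i $ j)"
  have inv: "?P ** matrix_inv ?P = mat 1"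
    by (rule matrix_inv_inverse[OF pos_def_invertible[OF pd]])
  define x :: "real^'n" where "x = (\<chi> i. matrix_inv ?P $ i $ v)"
  have Px: "?P *v x = (\<chi> i. if i = v then 1 else 0)"
    using inv by (simp add: matrix_matrix_mult_def mat_def vec_eq_iff x_def matrix_vector_mult_def)
  have "M = (\<chi> i j. if j = v then (?P *v x) $ i else ?P $ i $ j)"
    unfolding Px M_def by (simp add: vec_eq_iff)
  then have M1: "det M = precision ?T S $ v $ v * det ?P"
    using cramer_lemma[of v ?P x] by (simp add: x_def precision_def)
  \<comment> \<open>\<open>M\<close> arises from the smaller principal matrix by adding to row \<open>v\<close> a combination of rows in \<open>A\<close>.\<close>
  define y :: "real^'n" where
    "y = (\<chi> i. if i = v then 1 else \<Sum>k\<in>A. S $ v $ k * precision A S $ k $ i)"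
  have pdA: "pos_def (principal A S)" by (rule pos_def_principal_subset[OF pd]) auto
  have "M = (\<chi> i. if i = v then sum (\<lambda>i. y$i *s row i ?Q) UNIV else row i ?Q)"
  proof -
    have "M $ i $ j = (\<chi> i. if i = v then sum (\<lambda>i. y$i *s row i ?Q) UNIV else row i ?Q) $ i $ j" for i j
    proof (cases "i = v")
      case False
      then show ?thesis using v by (auto simp: M_def principal_def row_def)
    next
      case True
      have "(\<Sum>i\<in>UNIV. y $ i * ?Q $ i $ j) = M $ v $ j"
      proof (cases "j \<in> A")
        case True
        have "(\<Sum>i\<in>UNIV. y $ i * ?Q $ i $ j) = (\<Sum>i\<in>A. y $ i * S $ i $ j)"
          using True by (intro sum.mono_neutral_cong_right) (auto simp: principal_def)
        also have "\<dots> = (\<Sum>i\<in>A. (\<Sum>k\<in>A. S $ v $ k * precision A S $ k $ i) * S $ i $ j)"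
          using v by (intro sum.cong) (auto simp: y_def)
        also have "\<dots> = (\<Sum>k\<in>A. S $ v $ k * (\<Sum>i\<in>A. precision A S $ k $ i * S $ i $ j))"
          unfolding sum_distrib_left sum_distrib_right by (subst sum.swap) (simp add: mult.assoc)
        also have "\<dots> = (\<Sum>k\<in>A. if k = j then S $ v $ k else 0)"
          using True pdA by (intro sum.cong) (auto simp: precision_mult)
        also have "\<dots> = M $ v $ j" using True v by (auto simp: M_def principal_def)
        finally show ?thesis .
      next
        case False
        then have "(\<Sum>i\<in>UNIV. y $ i * ?Q $ i $ j) = (\<Sum>i\<in>{j}. y $ i * ?Q $ i $ j)"
          by (intro sum.mono_neutral_right) (auto simp: principal_def)
        also have "\<dots> = y $ j" using False by (simp add: principal_def)
        also have "\<dots> = M $ v $ j" using False by (auto simp: y_def M_def principal_def)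
        finally show ?thesis .
      qed
      with True show ?thesis by (simp add: row_def sum_component)
    qed
    then show ?thesis by (simp add: vec_eq_iff)
  qed
  then have "det M = det ?Q"
    using cramer_lemma_transpose[of v y ?Q] by (simp add: y_def)
  with M1 show ?thesis by simp
qed

lemma det_principal_pos:
  fixes S :: "real^'n::finite^'n"
  assumes "pos_def (principal A S)"
  shows "0 < det (principal A S)"
proof -
  have "finite A" by simp
  then show ?thesis using assms
  proof (induction A)
    case empty
    then show ?case by simp
  next
    case (insert v A)
    have "pos_def (principal A S)" by (rule pos_def_principal_subset[OF insert.prems]) auto
    then have "0 < det (principal A S)" by (rule insert.IH)
    then have "0 < precision (insert v A) S $ v $ v * det (principal (insert v A) S)"
      using det_principal_remove[OF insert.prems insert.hyps(2)] by simp
    moreover have "0 < precision (insert v A) S $ v $ v"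
      by (rule precision_diag_pos[OF insert.prems]) simp
    ultimately show ?case by (simp add: zero_less_mult_iff)
  qed
qed

text \<open>
  The conditional variance is the reciprocal of the diagonal entry of the precision matrix: solve
  the equations of row \<open>j\<close> for the entries at the parents and insert them into the equation at \<open>j\<close>.
\<close>

lemma cond_var_precision:
  fixes S :: "real^'n::finite^'n"
  assumes pd: "pos_def (principal (insert j (pa D j)) S)"
  shows "precision (insert j (pa D j)) S $ j $ j * cond_var D S j = 1"
proof -
  let ?A = "pa D j" and ?T = "insert j (pa D j)"
  let ?a = "\<lambda>k. precision ?T S $ j $ k"
  have j: "j \<notin> ?A" by (simp add: pa_def)
  have pdA: "pos_def (principal ?A S)" by (rule pos_def_principal_subset[OF pd]) auto
  have eq: "?a j * S $ j $ b + (\<Sum>k\<in>?A. ?a k * S $ k $ b) = (if j = b then 1 else 0)"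
    if "b \<in> ?T" for b
    using precision_mult[OF pd _ that, of j] j by simp
  have ak: "?a k = - ?a j * (\<Sum>l\<in>?A. S $ j $ l * precision ?A S $ l $ k)" if k: "k \<in> ?A" for k
  proof -
    have "?a k = (\<Sum>l\<in>?A. ?a l * (\<Sum>b\<in>?A. S $ l $ b * precision ?A S $ b $ k))"
      using k by (simp add: mult_precision[OF pdA] if_distrib[of "\<lambda>x. _ * x"] cong: if_cong)
    also have "\<dots> = (\<Sum>b\<in>?A. (\<Sum>l\<in>?A. ?a l * S $ l $ b) * precision ?A S $ b $ k)"
      unfolding sum_distrib_left sum_distrib_right by (subst sum.swap) (simp add: mult.assoc)
    also have "\<dots> = (\<Sum>b\<in>?A. - ?a j * (S $ j $ b * precision ?A S $ b $ k))"
    proof (rule sum.cong)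
      fix b assume "b \<in> ?A"
      then have "?a j * S $ j $ b + (\<Sum>l\<in>?A. ?a l * S $ l $ b) = 0" using eq[of b] j by auto
      then have "(\<Sum>l\<in>?A. ?a l * S $ l $ b) = - ?a j * S $ j $ b" by simp
      then show "(\<Sum>l\<in>?A. ?a l * S $ l $ b) * precision ?A S $ b $ k
        = - ?a j * (S $ j $ b * precision ?A S $ b $ k)" by simp
    qed simp
    finally show ?thesis by (simp add: sum_distrib_left)
  qed
  have "(\<Sum>k\<in>?A. ?a k * S $ k $ j)
      = - ?a j * (\<Sum>k\<in>?A. \<Sum>l\<in>?A. S $ j $ l * precision ?A S $ l $ k * S $ k $ j)"
    by (simp add: ak sum_distrib_left sum_distrib_right mult.assoc sum_negf)
  also have "(\<Sum>k\<in>?A. \<Sum>l\<in>?A. S $ j $ l * precision ?A S $ l $ k * S $ k $ j)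
      = (\<Sum>l\<in>?A. \<Sum>k\<in>?A. S $ j $ l * matrix_inv (principal ?A S) $ l $ k * S $ k $ j)"
    by (subst sum.swap) (simp add: precision_def)
  finally show ?thesis using eq[of j] by (simp add: cond_var_def algebra_simps)
qed

section \<open>Gaussian marginals and conditional independence\<close>

text \<open>
  Completing the square in the coordinate \<open>v\<close>.
\<close>

lemma precision_quad_remove:
  assumes pd: "pos_def (principal T S)" and v: "v \<in> T"
  shows "x \<bullet> (precision T S *v x) = x \<bullet> (precision (T - {v}) S *v x)
    + (\<Sum>k\<in>UNIV. precision T S $ v $ k * x $ k)\<^sup>2 / precision T S $ v $ v"
proof -
  let ?K = "precision T S"
  have "(\<Sum>k\<in>UNIV. ?K $ v $ k * x $ k)\<^sup>2 / ?K $ v $ v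
      = (\<Sum>i\<in>UNIV. \<Sum>j\<in>UNIV. x $ i * (?K $ i $ v * ?K $ v $ j / ?K $ v $ v) * x $ j)"
    unfolding power2_eq_square sum_product sum_divide_distrib
  proof (intro sum.cong refl)
    fix i j
    show "?K $ v $ i * x $ i * (?K $ v $ j * x $ j) / ?K $ v $ v
        = x $ i * (?K $ i $ v * ?K $ v $ j / ?K $ v $ v) * x $ j"
      unfolding precision_sym[OF pd, of i v] by simp
  qed
  then show ?thesis
    by (simp add: inner_mult_vec_sum precision_remove[OF pd v] algebra_simps sum_subtractf)
qed

text \<open>
  A row that vanishes outside \<open>T'\<close> already solves the equations for \<open>T'\<close>.
\<close>

lemma precision_row_restrict:
  assumes pd: "pos_def (principal T S)" and T': "T' \<subseteq> T" and j: "j \<in> T'"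
    and zero: "\<And>k. k \<in> T - T' \<Longrightarrow> precision T S $ j $ k = 0"
  shows "precision T' S $ j $ k = precision T S $ j $ k"
proof (cases "k \<in> T'")
  case True
  have "precision T S $ j $ k = precision T' S $ j $ k"
  proof (rule precision_row_unique[OF _ j True])
    show "pos_def (principal T' S)" by (rule pos_def_principal_subset[OF pd T'])
    fix l assume l: "l \<in> T'"
    have "(\<Sum>k\<in>T'. precision T S $ j $ k * S $ k $ l) = (\<Sum>k\<in>T. precision T S $ j $ k * S $ k $ l)"
      using T' zero by (intro sum.mono_neutral_left) auto
    then show "(\<Sum>k\<in>T'. precision T S $ j $ k * S $ k $ l) = (if j = l then 1 else 0)"
      using precision_mult[OF pd, of j l] l j T' by (simp add: subset_iff)
  qed
  then show ?thesis ..
next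
  case False
  then show ?thesis using zero by (cases "k \<in> T") auto
qed

lemma nn_integral_gaussian:
  fixes a b :: real
  assumes "0 < a"
  shows "(\<integral>\<^sup>+t. ennreal (exp (- (a * t + b)\<^sup>2 / (2 * a))) \<partial>lborel) = ennreal (sqrt (2 * pi / a))"
proof -
  have "exp (- (a * t + b)\<^sup>2 / (2 * a)) = sqrt (2 * pi / a) * normal_density (- b / a) (1 / sqrt a) t" for t
  proof -
    have "(a * t + b)\<^sup>2 / (2 * a) = (t - - b / a)\<^sup>2 / (2 * (1 / sqrt a)\<^sup>2)"
      using assms by (simp add: power_divide field_simps power2_eq_square)
    moreover have "sqrt (2 * pi * (1 / sqrt a)\<^sup>2) = sqrt (2 * pi / a)"
      using assms by (simp add: power_divide)
    ultimately show ?thesis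
      using assms by (simp add: normal_density_def)
  qed
  then have "(\<integral>\<^sup>+t. ennreal (exp (- (a * t + b)\<^sup>2 / (2 * a))) \<partial>lborel)
      = (\<integral>\<^sup>+t. ennreal (sqrt (2 * pi / a)) * ennreal (normal_density (- b / a) (1 / sqrt a) t) \<partial>lborel)"
    using assms by (simp add: ennreal_mult')
  also have "\<dots> = ennreal (sqrt (2 * pi / a)) * (\<integral>\<^sup>+t. ennreal (normal_density (- b / a) (1 / sqrt a) t) \<partial>lborel)"
    by (rule nn_integral_cmult) simp
  also have "(\<integral>\<^sup>+t. ennreal (normal_density (- b / a) (1 / sqrt a) t) \<partial>lborel) = 1"
    using assms by (subst nn_integral_eq_integral) auto
  finally show ?thesis by simp
qed

text \<open>
  Marginal densities with values in the extended nonnegative reals, where iterated integration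
  needs no integrability.
\<close>

definition nn_marginal :: "(real^'n::finite \<Rightarrow> real) \<Rightarrow> 'n set \<Rightarrow> real^'n \<Rightarrow> ennreal" where
  "nn_marginal f T x =
    (\<integral>\<^sup>+y. ennreal (f (\<chi> i. if i \<in> T then x $ i else y i)) \<partial>(\<Pi>\<^sub>M i\<in>- T. lborel))"

lemma gaussian_merge_measurable:
  "(\<lambda>y. gaussian_density S (\<chi> i. if i \<in> T then x $ i else y i))
    \<in> borel_measurable (\<Pi>\<^sub>M i\<in>- T. lborel)"
proof -
  have [measurable]: "(\<lambda>y. if i \<in> T then x $ i else y i) \<in> borel_measurable (\<Pi>\<^sub>M i\<in>- T. lborel)" for i
    by (cases "i \<in> T") simp_all
  show ?thesis
    unfolding gaussian_density_def inner_mult_vec_sum by simp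
qed

lemma nn_marginal_remove:
  assumes j: "j \<in> T"
  shows "nn_marginal (gaussian_density S) (T - {j}) x =
    (\<integral>\<^sup>+t. nn_marginal (gaussian_density S) T (\<chi> i. if i = j then t else x $ i) \<partial>lborel)"
proof -
  let ?F = "\<lambda>y. ennreal (gaussian_density S (\<chi> i. if i \<in> T - {j} then x $ i else y i))"
  have compl: "- (T - {j}) = insert j (- T)" using j by auto
  interpret product_sigma_finite "\<lambda>_. lborel" ..
  have meas: "?F \<in> borel_measurable (\<Pi>\<^sub>M i\<in>insert j (- T). lborel)"
    using gaussian_merge_measurable[where T = "T - {j}" and S = S and x = x] unfolding compl by simp
  have "nn_marginal (gaussian_density S) (T - {j}) x
      = (\<integral>\<^sup>+t. (\<integral>\<^sup>+y. ?F (y(j := t)) \<partial>(\<Pi>\<^sub>M i\<in>- T. lborel)) \<partial>lborel)"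
    unfolding nn_marginal_def compl
    by (rule product_nn_integral_insert_rev) (use j meas in auto)
  also have "\<dots> = (\<integral>\<^sup>+t. nn_marginal (gaussian_density S) T (\<chi> i. if i = j then t else x $ i) \<partial>lborel)"
  proof -
    have "(\<chi> i. if i \<in> T - {j} then x $ i else (y(j := t)) i)
        = (\<chi> i. if i \<in> T then (\<chi> i. if i = j then t else x $ i) $ i else y i)" for y t
      using j by (auto simp: vec_eq_iff)
    then show ?thesis unfolding nn_marginal_def by simp
  qed
  finally show ?thesis .
qed

text \<open>
  The square completed in \<open>precision_quad_remove\<close> is the only place where coordinate \<open>j\<close> occurs, so
  integrating it out leaves the quadratic form of the smaller precision matrix. The change of the
  constant is recorded, since conditional independence compares constants too.
\<close>

lemma nn_marginal_gaussian_remove: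
  assumes pd: "pos_def S" and j: "j \<in> T" and c: "0 < c"
    and T: "\<And>x. nn_marginal (gaussian_density S) T x = ennreal (c * exp (- (x \<bullet> (precision T S *v x)) / 2))"
  shows "nn_marginal (gaussian_density S) (T - {j}) x =
    ennreal (c * sqrt (2 * pi / precision T S $ j $ j) * exp (- (x \<bullet> (precision (T - {j}) S *v x)) / 2))"
proof -
  note pdT = pos_def_principal[OF pd, of T]
  let ?K = "precision T S" and ?K' = "precision (T - {j}) S"
  let ?a = "?K $ j $ j" and ?b = "\<Sum>k\<in>UNIV - {j}. ?K $ j $ k * x $ k"
  let ?q = "x \<bullet> (?K' *v x)"
  have a: "0 < ?a" by (rule precision_diag_pos[OF pdT j])
  have quad: "y \<bullet> (?K *v y) = ?q + (?a * t + ?b)\<^sup>2 / ?a" if y: "y = (\<chi> i. if i = j then t else x $ i)" for y t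
  proof -
    have "y \<bullet> (?K' *v y) = ?q"
      unfolding inner_mult_vec_sum by (intro sum.cong refl) (simp add: y)
    moreover have "(\<Sum>k\<in>UNIV. ?K $ j $ k * y $ k) = ?a * t + ?b"
      by (subst sum.remove[of _ j]) (auto simp: y intro!: sum.cong)
    ultimately show ?thesis by (simp add: precision_quad_remove[OF pdT j])
  qed
  have eq: "nn_marginal (gaussian_density S) T (\<chi> i. if i = j then t else x $ i)
      = ennreal (c * exp (- ?q / 2)) * ennreal (exp (- (?a * t + ?b)\<^sup>2 / (2 * ?a)))" for t
  proof -
    have "exp (- (?q + (?a * t + ?b)\<^sup>2 / ?a) / 2)
        = exp (- ?q / 2) * exp (- (?a * t + ?b)\<^sup>2 / (2 * ?a))"
      unfolding exp_add[symmetric] by (simp add: add_divide_distrib mult.commute)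
    then show ?thesis
      unfolding T quad[OF refl] using c by (simp add: ennreal_mult'[symmetric] mult.assoc)
  qed
  have "nn_marginal (gaussian_density S) (T - {j}) x
      = ennreal (c * exp (- ?q / 2)) * (\<integral>\<^sup>+t. ennreal (exp (- (?a * t + ?b)\<^sup>2 / (2 * ?a))) \<partial>lborel)"
    unfolding nn_marginal_remove[OF j] eq by (rule nn_integral_cmult) simp
  also have "\<dots> = ennreal (c * exp (- ?q / 2) * sqrt (2 * pi / ?a))"
    unfolding nn_integral_gaussian[OF a] using c by (simp add: ennreal_mult')
  finally show ?thesis by (simp add: mult_ac)
qed

lemma nn_marginal_gaussian:
  fixes S :: "real^'n::finite^'n"
  assumes pd: "pos_def S"
  shows "\<exists>c>0. \<forall>x. nn_marginal (gaussian_density S) T x = ennreal (c * exp (- (x \<bullet> (precision T S *v x)) / 2))"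
proof -
  have "finite W \<Longrightarrow> \<exists>c>0. \<forall>x. nn_marginal (gaussian_density S) (- W) x
      = ennreal (c * exp (- (x \<bullet> (precision (- W) S *v x)) / 2))" for W
  proof (induction W rule: finite_induct)
    case empty
    have "0 < det S" using det_principal_pos[of UNIV S] pd by simp
    then have c: "0 < 1 / sqrt ((2 * pi) ^ CARD('n) * det S)" by simp
    interpret product_sigma_finite "\<lambda>_::'n. lborel :: real measure" ..
    have "nn_marginal (gaussian_density S) (- {}) x
        = ennreal (1 / sqrt ((2 * pi) ^ CARD('n) * det S) * exp (- (x \<bullet> (precision (- {}) S *v x)) / 2))" for x
    proof -
      have "nn_marginal (gaussian_density S) (- {}) x = ennreal (gaussian_density S x)"
        unfolding nn_marginal_def Compl_UNIV_eq double_complement by (subst nn_integral_empty) simp_all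
      then show ?thesis by (simp add: gaussian_density_def precision_UNIV)
    qed
    with c show ?case by blast
  next
    case (insert j W)
    then obtain c where c: "c > 0" "\<And>x. nn_marginal (gaussian_density S) (- W) x
        = ennreal (c * exp (- (x \<bullet> (precision (- W) S *v x)) / 2))" by auto
    have j: "j \<in> - W" using insert by simp
    have eq: "- W - {j} = - insert j W" by auto
    have "0 < c * sqrt (2 * pi / precision (- W) S $ j $ j)"
      using c(1) precision_diag_pos[OF pos_def_principal[OF pd] j] by simp
    with nn_marginal_gaussian_remove[OF pd j c] show ?case unfolding eq by blast
  qed
  from this[of "- T"] show ?thesis by simp
qed

lemma marginal_density_nn_marginal:
  assumes "pos_def S"
  shows "marginal_density (gaussian_density S) T x = enn2real (nn_marginal (gaussian_density S) T x)"
proof -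
  have "0 \<le> gaussian_density S y" for y
    using det_principal_pos[of UNIV S] assms by (simp add: gaussian_density_def)
  then show ?thesis
    unfolding marginal_density_def nn_marginal_def
    by (intro integral_eq_nn_integral gaussian_merge_measurable) simp
qed

lemma marginal_gaussian_pos:
  assumes "pos_def S"
  shows "0 < marginal_density (gaussian_density S) T x"
  using nn_marginal_gaussian[OF assms, of T] unfolding marginal_density_nn_marginal[OF assms] by auto

text \<open>
  The conditional density of coordinate \<open>j\<close> given the others, where \<open>a\<close> is the row of \<open>j\<close> in the
  precision matrix.
\<close>

definition normal_factor :: "'n \<Rightarrow> ('n::finite \<Rightarrow> real) \<Rightarrow> real^'n \<Rightarrow> real" where
  "normal_factor j a x = sqrt (a j / (2 * pi)) * exp (- (\<Sum>k\<in>UNIV. a k * x $ k)\<^sup>2 / (2 * a j))"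

text \<open>
  Dividing by the marginal density without \<open>j\<close> leaves an expression in which \<open>T\<close> enters only through
  the row of \<open>j\<close>; no determinants have to be compared.
\<close>

lemma marginal_gaussian_conditional:
  assumes pd: "pos_def S" and j: "j \<in> T"
  shows "marginal_density (gaussian_density S) T x =
    marginal_density (gaussian_density S) (T - {j}) x * normal_factor j (\<lambda>k. precision T S $ j $ k) x"
proof -
  obtain c where c: "c > 0" "\<And>x. nn_marginal (gaussian_density S) T x
      = ennreal (c * exp (- (x \<bullet> (precision T S *v x)) / 2))"
    using nn_marginal_gaussian[OF pd] by metis
  let ?a = "precision T S $ j $ j"
  have pdT: "pos_def (principal T S)" by (rule pos_def_principal[OF pd])
  have a: "0 < ?a" by (rule precision_diag_pos[OF pdT j])
  have "sqrt (2 * pi / ?a) * sqrt (?a / (2 * pi)) = 1"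
    unfolding real_sqrt_mult[symmetric] using a by simp
  moreover have "exp (- (x \<bullet> (precision T S *v x)) / 2)
    = exp (- (x \<bullet> (precision (T - {j}) S *v x)) / 2)
      * exp (- (\<Sum>k\<in>UNIV. precision T S $ j $ k * x $ k)\<^sup>2 / (2 * ?a))"
    unfolding exp_add[symmetric] precision_quad_remove[OF pdT j]
    by (simp add: add_divide_distrib mult.commute)
  ultimately show ?thesis
    unfolding marginal_density_nn_marginal[OF pd] c nn_marginal_gaussian_remove[OF pd j c]
    using c(1) a by (simp add: normal_factor_def mult_ac)
qed

text \<open>
  Evaluation at \<open>0\<close> gives the diagonal entry, and evaluation at unit vectors and at sums of
  two of them removes the sign ambiguity of the square.
\<close>

lemma normal_factor_inject:
  fixes a b :: "'n::finite \<Rightarrow> real"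
  assumes a: "0 < a j" and b: "0 < b j"
    and eq: "\<And>x. normal_factor j a x = normal_factor j b x"
  shows "a = b"
proof -
  have j: "a j = b j" using eq[of 0] by (simp add: normal_factor_def)
  have sq: "(\<Sum>k\<in>UNIV. a k * x $ k)\<^sup>2 = (\<Sum>k\<in>UNIV. b k * x $ k)\<^sup>2" for x
    using eq[of x] a b by (simp add: normal_factor_def j)
  have ax: "(\<Sum>k\<in>UNIV. c k * axis l 1 $ k) = c l" for c :: "'n \<Rightarrow> real" and l
    by (simp add: axis_def if_distrib cong: if_cong)
  show ?thesis
  proof
    fix k
    have "(a k)\<^sup>2 = (b k)\<^sup>2" using sq[of "axis k 1"] by (simp only: ax)
    moreover have "(a j + a k)\<^sup>2 = (b j + b k)\<^sup>2"
      using sq[of "axis j 1 + axis k 1"] by (simp only: vector_add_component distrib_left sum.distrib ax)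
    ultimately have "2 * a j * a k = 2 * a j * b k" using j by (simp add: power2_sum)
    then show "a k = b k" using a by simp
  qed
qed

text \<open>
  Both sides of the factorization are a marginal density times a conditional density of \<open>j\<close>, once
  given \<open>B \<union> A\<close> and once given \<open>A\<close>. So conditional independence means that the row of \<open>j\<close> is the
  same in both precision matrices, which happens iff the larger row vanishes on \<open>B\<close>.
\<close>

lemma cond_indep_gaussian_iff:
  fixes S :: "real^'n::finite^'n"
  assumes pd: "pos_def S" and j: "j \<notin> A" "j \<notin> B" and AB: "A \<inter> B = {}"
  shows "cond_indep (gaussian_density S) {j} B A \<longleftrightarrow>
    (\<forall>k\<in>B. precision (insert j (B \<union> A)) S $ j $ k = 0)"
proof -
  let ?m = "marginal_density (gaussian_density S)"
  let ?T = "insert j (B \<union> A)" and ?T' = "insert j A"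
  let ?a = "\<lambda>k. precision ?T S $ j $ k" and ?a' = "\<lambda>k. precision ?T' S $ j $ k"
  have sets: "{j} \<union> B \<union> A = ?T" "{j} \<union> A = ?T'" "?T - {j} = B \<union> A" "?T' - {j} = A"
    using j by auto
  have T: "?m ?T x = ?m (B \<union> A) x * normal_factor j ?a x"
    and T': "?m ?T' x = ?m A x * normal_factor j ?a' x" for x
    using marginal_gaussian_conditional[OF pd, of j ?T x] marginal_gaussian_conditional[OF pd, of j ?T' x]
    by (simp_all only: sets insertI1 simp_thms)
  have pos: "?m (B \<union> A) x * ?m A x > 0" for x by (simp add: marginal_gaussian_pos[OF pd])
  have "cond_indep (gaussian_density S) {j} B A \<longleftrightarrow> (\<forall>x. normal_factor j ?a x = normal_factor j ?a' x)"
  proof -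
    have "?m ?T x * ?m A x = ?m ?T' x * ?m (B \<union> A) x \<longleftrightarrow>
      (?m (B \<union> A) x * ?m A x) * normal_factor j ?a x = (?m (B \<union> A) x * ?m A x) * normal_factor j ?a' x" for x
      unfolding T T' by (simp add: mult_ac)
    also have "\<dots> x \<longleftrightarrow> normal_factor j ?a x = normal_factor j ?a' x" for x
      using pos[of x] by (simp only: mult_cancel_left) auto
    finally show ?thesis unfolding cond_indep_def sets by simp
  qed
  also have "\<dots> \<longleftrightarrow> ?a = ?a'"
  proof
    assume "\<forall>x. normal_factor j ?a x = normal_factor j ?a' x"
    then show "?a = ?a'"
      using precision_diag_pos[OF pos_def_principal[OF pd]] by (intro normal_factor_inject[of _ j]) auto
  next
    assume eq: "?a = ?a'"
    show "\<forall>x. normal_factor j ?a x = normal_factor j ?a' x" unfolding eq by simp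
  qed
  also have "\<dots> \<longleftrightarrow> (\<forall>k\<in>B. ?a k = 0)"
  proof
    assume eq: "?a = ?a'"
    show "\<forall>k\<in>B. ?a k = 0"
    proof
      fix k assume "k \<in> B"
      then have "k \<notin> ?T'" using j AB by auto
      then have "?a' k = 0" by simp
      then show "?a k = 0" using fun_cong[OF eq, of k] by simp
    qed
  next
    assume "\<forall>k\<in>B. ?a k = 0"
    then show "?a = ?a'"
      by (intro ext precision_row_restrict[symmetric] pos_def_principal[OF pd]) auto
  qed
  finally show ?thesis .
qed

section \<open>Perfect acyclic orientations\<close>

lemma skeleton_iff: "{i, j} \<in> skeleton D \<longleftrightarrow> i = j \<or> (i, j) \<in> D \<or> (j, i) \<in> D"
  by (auto simp: skeleton_def doubleton_eq_iff)

lemma acyclic_irrefl_edge: "acyclic D \<Longrightarrow> (i, i) \<notin> D"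
  by (auto simp: acyclic_def)

lemma pa_iff: "acyclic D \<Longrightarrow> i \<in> pa D j \<longleftrightarrow> (i, j) \<in> D"
  by (auto simp: pa_def acyclic_def)

lemma not_in_pa [simp]: "j \<notin> pa D j"
  by (simp add: pa_def)

lemma pa_subset_nondesc:
  assumes "acyclic D" shows "pa D j \<subseteq> nondesc D j"
  using assms by (auto simp: pa_def nondesc_def acyclic_def dest: trancl_into_trancl2)

text \<open>
  Sets of the form \<open>insert j (nondesc D j)\<close> are closed under taking parents.
\<close>

lemma family_subset_nondesc:
  assumes "acyclic D" and "k \<in> nondesc D j"
  shows "insert k (pa D k) \<subseteq> nondesc D j"
  using assms by (auto simp: pa_def nondesc_def dest: trancl_into_trancl)

lemma directed_local_markov_gaussian_iff:
  assumes ac: "acyclic D" and pd: "pos_def S"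
  shows "directed_local_markov D (gaussian_density S) \<longleftrightarrow>
    (\<forall>j. \<forall>k\<in>nondesc D j - pa D j. precision (insert j (nondesc D j)) S $ j $ k = 0)"
proof -
  have "cond_indep (gaussian_density S) {j} (nondesc D j - pa D j) (pa D j) \<longleftrightarrow>
    (\<forall>k\<in>nondesc D j - pa D j. precision (insert j (nondesc D j)) S $ j $ k = 0)" for j
  proof -
    have un: "(nondesc D j - pa D j) \<union> pa D j = nondesc D j"
      using pa_subset_nondesc[OF ac, of j] by auto
    have "j \<notin> nondesc D j - pa D j" by (simp add: nondesc_def)
    then show ?thesis
      using cond_indep_gaussian_iff[OF pd, of j "pa D j" "nondesc D j - pa D j"] unfolding un by auto
  qed
  then show ?thesis unfolding directed_local_markov_def by simp
qed

lemma family_complete: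
  assumes pf: "perfect_dag D" and i: "i \<in> insert j (pa D j)" and k: "k \<in> insert j (pa D j)"
  shows "{i, k} \<in> skeleton D"
proof (cases "i \<in> pa D j \<and> k \<in> pa D j \<and> i \<noteq> k")
  case True
  then have "(i, k) \<in> D \<or> (k, i) \<in> D" using pf unfolding perfect_dag_def by blast
  then show ?thesis by (simp add: skeleton_iff)
next
  case False
  then show ?thesis using i k by (auto simp: skeleton_iff pa_def)
qed

lemma matrix_mult_entry: "(A ** B) $ i $ j = (\<Sum>k\<in>UNIV. A $ i $ k * B $ k $ j)"
  by (simp add: matrix_matrix_mult_def)

text \<open>
  Up to the factor \<open>regression_row D S j j\<close>, these are \<open>1\<close> at \<open>j\<close> and the negative coefficients of the
  regression of coordinate \<open>j\<close> on its parents.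
\<close>

definition regression_row :: "'n::finite rel \<Rightarrow> real^'n^'n \<Rightarrow> 'n \<Rightarrow> 'n \<Rightarrow> real" where
  "regression_row D S j k = precision (insert j (pa D j)) S $ j $ k"

text \<open>
  The factorization \<open>L\<^sup>T N L\<close> with the regression rows as the rows of \<open>L\<close> and the diagonal matrix \<open>N\<close>
  of the reciprocals of the diagonal of \<open>L\<close>. Only the entries of \<open>S\<close> at a vertex and its parents, or
  between two parents of a vertex, enter.
\<close>

definition dag_precision :: "'n::finite rel \<Rightarrow> real^'n^'n \<Rightarrow> real^'n^'n" where
  "dag_precision D S = (\<chi> i k. \<Sum>j\<in>UNIV.
     regression_row D S j i * regression_row D S j k / regression_row D S j j)"

lemma regression_row_outside: "k \<notin> insert j (pa D j) \<Longrightarrow> regression_row D S j k = 0"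
  unfolding regression_row_def by (rule precision_outside)

lemma regression_row_diag_pos:
  "pos_def (principal (insert j (pa D j)) S) \<Longrightarrow> 0 < regression_row D S j j"
  unfolding regression_row_def by (rule precision_diag_pos) simp_all

lemma dag_precision_factor:
  "dag_precision D S = transpose (\<chi> j k. regression_row D S j k)
    ** (\<chi> i j. if i = j then 1 / regression_row D S j j else 0) ** (\<chi> j k. regression_row D S j k)"
  by (simp add: dag_precision_def matrix_matrix_mult_def transpose_def vec_eq_iff
      if_distrib[of "\<lambda>x. _ * x"] cong: if_cong)

lemma dag_precision_pattern:
  assumes pf: "perfect_dag D" and ik: "{i, k} \<notin> skeleton D"
  shows "dag_precision D S $ i $ k = 0"
proof -
  have "regression_row D S j i * regression_row D S j k = 0" for j
  proof (rule ccontr)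
    assume "regression_row D S j i * regression_row D S j k \<noteq> 0"
    then have "i \<in> insert j (pa D j)" "k \<in> insert j (pa D j)"
      using regression_row_outside by (metis mult_eq_0_iff)+
    then show False using ik family_complete[OF pf] by blast
  qed
  then show ?thesis by (simp only: dag_precision_def vec_lambda_beta) simp
qed

text \<open>
  By the Markov property, \<open>L S\<close> agrees with the identity matrix at every \<open>(j, b)\<close> such that \<open>b\<close> is
  \<open>j\<close> or a nondescendant of \<open>j\<close>. If \<open>k\<close> is a nondescendant of \<open>j\<close>, so are the parents of \<open>k\<close>; hence
  \<open>L S L\<^sup>T\<close> vanishes at \<open>(j, k)\<close>. Of two vertices at least one is a nondescendant of the other, so by
  symmetry \<open>L S L\<^sup>T\<close> is diagonal, with the diagonal of \<open>L\<close>.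
\<close>

lemma markov_imp_matrix_inv:
  assumes ac: "acyclic D" and pd: "pos_def S"
    and markov: "\<And>j k. k \<in> nondesc D j - pa D j \<Longrightarrow> precision (insert j (nondesc D j)) S $ j $ k = 0"
  shows "matrix_inv S = dag_precision D S"
proof -
  let ?R = "regression_row D S"
  define L :: "real^'a^'a" where "L = (\<chi> j k. ?R j k)"
  define N :: "real^'a^'a" where "N = (\<chi> i j. if i = j then 1 / ?R j j else 0)"
  have R: "?R j k = precision (insert j (nondesc D j)) S $ j $ k" for j k
    unfolding regression_row_def
    by (rule precision_row_restrict[OF pos_def_principal[OF pd]])
      (use pa_subset_nondesc[OF ac, of j] markov in auto)
  have Rpos: "0 < ?R j j" for j by (rule regression_row_diag_pos[OF pos_def_principal[OF pd]])
  have LS: "(L ** S) $ j $ b = (if j = b then 1 else 0)" if "b \<in> insert j (nondesc D j)" for j b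
  proof -
    let ?T = "insert j (nondesc D j)"
    have "(L ** S) $ j $ b = (\<Sum>k\<in>?T. precision ?T S $ j $ k * S $ k $ b)"
      unfolding L_def matrix_matrix_mult_def
      by (simp add: R) (intro sum.mono_neutral_right, auto)
    also have "\<dots> = (if j = b then 1 else 0)"
      using that by (intro precision_mult pos_def_principal pd) auto
    finally show ?thesis .
  qed
  have M: "(L ** S ** transpose L) $ j $ k = (if j = k then ?R j j else 0)"
    if k: "k \<in> insert j (nondesc D j)" for j k
  proof -
    have "(L ** S ** transpose L) $ j $ k = (\<Sum>b\<in>UNIV. (L ** S) $ j $ b * ?R k b)"
    proof -
      have "transpose L $ b $ k = ?R k b" for b by (simp add: transpose_def L_def)
      then show ?thesis unfolding matrix_mult_entry[of "L ** S"] by simp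
    qed
    also have "\<dots> = (\<Sum>b\<in>insert k (pa D k). (L ** S) $ j $ b * ?R k b)"
      using regression_row_outside by (intro sum.mono_neutral_right) auto
    also have "\<dots> = (\<Sum>b\<in>insert k (pa D k). if j = b then ?R k b else 0)"
    proof (rule sum.cong)
      fix b assume "b \<in> insert k (pa D k)"
      then have "b \<in> insert j (nondesc D j)"
        using k family_subset_nondesc[OF ac, of k j] pa_subset_nondesc[OF ac, of j] by auto
      then show "(L ** S) $ j $ b * ?R k b = (if j = b then ?R k b else 0)" by (simp add: LS)
    qed simp
    also have "\<dots> = (if j \<in> insert k (pa D k) then ?R k j else 0)" by simp
    also have "\<dots> = (if j = k then ?R j j else 0)"
    proof (cases "j = k")
      case False
      then have "k \<in> nondesc D j" using k by simp
      then have "j \<notin> insert k (pa D k)" using family_subset_nondesc[OF ac] by (auto simp: nondesc_def)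
      with False show ?thesis by simp
    qed simp
    finally show ?thesis .
  qed
  have sym: "transpose (L ** S ** transpose L) = L ** S ** transpose L"
    using pd by (simp add: matrix_transpose_mul pos_def_def matrix_mul_assoc)
  have "L ** S ** transpose L = (\<chi> j k. if j = k then ?R j j else 0)"
  proof -
    have "(L ** S ** transpose L) $ j $ k = (if j = k then ?R j j else 0)" for j k
    proof (cases "k \<in> insert j (nondesc D j)")
      case False
      then have "(j, k) \<in> D\<^sup>+" "j \<noteq> k" by (auto simp: nondesc_def)
      then have "j \<in> nondesc D k"
        using ac by (auto simp: nondesc_def acyclic_def dest: trancl_trans)
      then have "(L ** S ** transpose L) $ k $ j = (if k = j then ?R k k else 0)" by (intro M) simp
      moreover have "(L ** S ** transpose L) $ j $ k = (L ** S ** transpose L) $ k $ j"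
        using arg_cong[OF sym, of "\<lambda>A. A $ j $ k"] by (simp add: transpose_def)
      ultimately show ?thesis using \<open>j \<noteq> k\<close> by simp
    qed (rule M)
    then show ?thesis by (simp add: vec_eq_iff)
  qed
  then have "L ** S ** transpose L ** N = (\<chi> j k. if j = k then ?R j j else 0) ** N" by simp
  also have "\<dots> = mat 1"
  proof -
    have "?R j j \<noteq> 0" for j using Rpos[of j] by simp
    then show ?thesis
      by (simp add: N_def matrix_matrix_mult_def mat_def vec_eq_iff
          if_distrib[of "\<lambda>x. _ * x"] cong: if_cong)
  qed
  finally have "L ** (S ** transpose L ** N) = mat 1" by (simp add: matrix_mul_assoc)
  then have "(S ** transpose L ** N) ** L = mat 1" by (rule matrix_left_right_inverse1)
  then have "S ** (transpose L ** N ** L) = mat 1" by (simp add: matrix_mul_assoc)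
  then show ?thesis
    unfolding dag_precision_factor L_def N_def by (rule matrix_inv_eqI)
qed

text \<open>
  Remove the vertices outside \<open>T\<close> one by one, each being a sink at that time. Eliminating a sink
  changes the precision matrix only between its parents, and these are adjacent because the graph
  is perfect; so no new nonzero entries arise.
\<close>

lemma precision_pattern_ancestral:
  fixes S :: "real^'n::finite^'n"
  assumes ac: "acyclic D" and pf: "perfect_dag D" and pd: "pos_def S"
    and pattern: "\<And>i j. {i, j} \<notin> skeleton D \<Longrightarrow> matrix_inv S $ i $ j = 0"
    and anc: "\<And>j. j \<in> T \<Longrightarrow> pa D j \<subseteq> T" and ij: "{i, j} \<notin> skeleton D"
  shows "precision T S $ i $ j = 0"
  using anc ij
proof (induction "card (- T)" arbitrary: T i j)
  case 0
  then have "T = UNIV" by auto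
  then show ?case using pattern "0.prems"(2) by (simp add: precision_UNIV)
next
  case (Suc n)
  then have "- T \<noteq> {}" by (metis card.empty nat.distinct(1))
  \<comment> \<open>A vertex outside \<open>T\<close> with all parents in \<open>T\<close> is a sink of \<open>insert v T\<close>, since \<open>T\<close> is ancestral.\<close>
  then obtain w where "w \<in> - T" by blast
  moreover have "wf D" using ac by (intro finite_acyclic_wf) simp_all
  ultimately obtain v where v: "v \<in> - T" "\<And>u. (u, v) \<in> D \<Longrightarrow> u \<notin> - T"
    by (metis wf_eq_minimal)
  let ?T = "insert v T" and ?K = "precision (insert v T) S"
  have pdT: "pos_def (principal ?T S)" by (rule pos_def_principal[OF pd])
  have T: "?T - {v} = T" using v by auto
  have "n = card (- ?T)" using Suc.hyps(2) v(1) by (simp add: Compl_insert card_Diff_singleton_if)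
  moreover have "pa D k \<subseteq> ?T" if "k \<in> ?T" for k
    using that Suc.prems(1) v(2) unfolding pa_def by blast
  ultimately have IH: "?K $ i $ j = 0" if "{i, j} \<notin> skeleton D" for i j
    using Suc.hyps(1) that by blast
  have "?K $ i $ v * ?K $ v $ j = 0"
  proof (rule ccontr)
    assume nz: "?K $ i $ v * ?K $ v $ j \<noteq> 0"
    then have in_T: "i \<in> ?T" "j \<in> ?T" by (metis precision_outside mult_eq_0_iff)+
    have "{i, v} \<in> skeleton D" "{v, j} \<in> skeleton D" using nz IH by auto
    moreover have "(v, k) \<notin> D" if "k \<in> ?T" for k
      using that v(1) Suc.prems(1)[of k] pa_iff[OF ac] acyclic_irrefl_edge[OF ac] by blast
    ultimately have "i \<in> insert v (pa D v)" "j \<in> insert v (pa D v)"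
      using in_T by (auto simp: skeleton_iff pa_iff[OF ac])
    then show False using Suc.prems(2) family_complete[OF pf] by blast
  qed
  then show ?case
    using precision_remove[OF pdT, of v i j] IH[OF Suc.prems(2)] unfolding T by simp
qed

text \<open>
  From left to right, use the factorization of \<open>\<Omega>\<close> into regression rows. From right to left, a
  nondescendant of \<open>j\<close> other than a parent is not adjacent to \<open>j\<close>, and the vertices \<open>j\<close> and its
  nondescendants form an ancestral set, so that the precision matrix on it keeps the zeros of \<open>\<Omega>\<close>.
\<close>

theorem P_dag_eq_P_graph:
  fixes D :: "'n::finite rel"
  assumes ac: "acyclic D" and pf: "perfect_dag D"
  shows "P_dag D = P_graph (skeleton D)"
proof (intro set_eqI iffI)
  fix \<Omega> :: "real^'n^'n" assume "\<Omega> \<in> P_dag D"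
  then obtain S where S: "pos_def S" "directed_local_markov D (gaussian_density S)" "\<Omega> = matrix_inv S"
    unfolding P_dag_def by auto
  have "\<Omega> = dag_precision D S"
    using S markov_imp_matrix_inv[OF ac S(1)] by (simp add: directed_local_markov_gaussian_iff[OF ac S(1)])
  then show "\<Omega> \<in> P_graph (skeleton D)"
    using pos_def_matrix_inv[OF S(1)] S(3) dag_precision_pattern[OF pf]
    unfolding P_graph_def by auto
next
  fix \<Omega> :: "real^'n^'n" assume "\<Omega> \<in> P_graph (skeleton D)"
  then have \<Omega>: "pos_def \<Omega>" "\<And>i j. {i, j} \<notin> skeleton D \<Longrightarrow> \<Omega> $ i $ j = 0" by (auto simp: P_graph_def)
  define S where "S = matrix_inv \<Omega>"
  have S: "pos_def S" "matrix_inv S = \<Omega>"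
    using \<Omega>(1) by (simp_all add: S_def pos_def_matrix_inv matrix_inv_matrix_inv pos_def_invertible)
  have "precision (insert j (nondesc D j)) S $ j $ k = 0" if k: "k \<in> nondesc D j - pa D j" for j k
  proof (rule precision_pattern_ancestral[OF ac pf S(1)])
    show "matrix_inv S $ i $ j = 0" if "{i, j} \<notin> skeleton D" for i j using \<Omega>(2) that S(2) by simp
    show "pa D i \<subseteq> insert j (nondesc D j)" if "i \<in> insert j (nondesc D j)" for i
      using that family_subset_nondesc[OF ac, of i j] pa_subset_nondesc[OF ac, of j] by auto
    show "{j, k} \<notin> skeleton D" using k by (auto simp: skeleton_iff nondesc_def pa_def)
  qed
  then have "directed_local_markov D (gaussian_density S)"
    by (simp add: directed_local_markov_gaussian_iff[OF ac S(1)])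
  then show "\<Omega> \<in> P_dag D" unfolding P_dag_def using S by blast
qed

lemma PD_graph_matrix_inv:
  assumes ac: "acyclic D" and pf: "perfect_dag D" and S: "S \<in> PD_graph (skeleton D)"
  shows "pos_def S" and "matrix_inv S = dag_precision D S"
proof -
  from S have "S \<in> matrix_inv ` P_dag D" by (simp add: PD_graph_def P_dag_eq_P_graph[OF ac pf])
  then obtain S' where S': "pos_def S'" "directed_local_markov D (gaussian_density S')"
    "S = matrix_inv (matrix_inv S')"
    unfolding P_dag_def by auto
  then have eq: "S = S'" by (simp add: matrix_inv_matrix_inv pos_def_invertible)
  show "pos_def S" using S'(1) eq by simp
  show "matrix_inv S = dag_precision D S"
    using S'(1,2) markov_imp_matrix_inv[OF ac S'(1)] eq
    by (simp add: directed_local_markov_gaussian_iff[OF ac S'(1)])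
qed

lemma dag_precision_cong:
  assumes "\<And>j i k. i \<in> insert j (pa D j) \<Longrightarrow> k \<in> insert j (pa D j) \<Longrightarrow> S $ i $ k = S' $ i $ k"
  shows "dag_precision D S = dag_precision D S'"
proof -
  have "regression_row D S = regression_row D S'"
    unfolding regression_row_def by (intro ext arg_cong[where f = "\<lambda>A. A $ _ $ _"] precision_cong assms)
  then show ?thesis unfolding dag_precision_def by simp
qed

text \<open>
  The quadratic form is a positively weighted sum of squares of the linear forms given by the rows
  of \<open>L\<close>, and \<open>L\<close> is triangular with positive diagonal.
\<close>

lemma pos_def_dag_precision:
  fixes D :: "'n::finite rel"
  assumes ac: "acyclic D" and pd: "\<And>j. pos_def (principal (insert j (pa D j)) \<Gamma>)"
  shows "pos_def (dag_precision D \<Gamma>)"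
  unfolding pos_def_def
proof (intro conjI allI impI)
  let ?R = "regression_row D \<Gamma>"
  have Rpos: "0 < ?R j j" for j by (rule regression_row_diag_pos[OF pd])
  show "transpose (dag_precision D \<Gamma>) = dag_precision D \<Gamma>"
    by (simp add: dag_precision_def transpose_def vec_eq_iff mult.commute)
  fix x :: "real^'n" assume "x \<noteq> 0"
  define q where "q j = (\<Sum>i\<in>UNIV. ?R j i * x $ i)" for j
  have quad: "x \<bullet> (dag_precision D \<Gamma> *v x) = (\<Sum>j\<in>UNIV. (q j)\<^sup>2 / ?R j j)"
  proof -
    have "x \<bullet> (dag_precision D \<Gamma> *v x)
        = (\<Sum>i\<in>UNIV. \<Sum>k\<in>UNIV. \<Sum>j\<in>UNIV. ?R j i * x $ i * (?R j k * x $ k) / ?R j j)"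
      by (simp add: inner_mult_vec_sum dag_precision_def sum_distrib_left sum_distrib_right mult_ac)
    also have "\<dots> = (\<Sum>i\<in>UNIV. \<Sum>j\<in>UNIV. \<Sum>k\<in>UNIV. ?R j i * x $ i * (?R j k * x $ k) / ?R j j)"
      by (rule sum.cong[OF refl], rule sum.swap)
    also have "\<dots> = (\<Sum>j\<in>UNIV. \<Sum>i\<in>UNIV. \<Sum>k\<in>UNIV. ?R j i * x $ i * (?R j k * x $ k) / ?R j j)"
      by (rule sum.swap)
    also have "\<dots> = (\<Sum>j\<in>UNIV. (q j)\<^sup>2 / ?R j j)"
      by (simp add: q_def power2_eq_square sum_product sum_divide_distrib)
    finally show ?thesis .
  qed
  have nonneg: "0 \<le> (q j)\<^sup>2 / ?R j j" for j using Rpos[of j] by simp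
  have "\<exists>j. q j \<noteq> 0"
  proof (rule ccontr)
    assume "\<not> (\<exists>j. q j \<noteq> 0)"
    then have q0: "q j = 0" for j by simp
    have "wf D" using ac by (intro finite_acyclic_wf) simp_all
    then have "x $ j = 0" for j
    proof (induction j rule: wf_induct_rule)
      case (less j)
      have "q j = (\<Sum>i\<in>insert j (pa D j). ?R j i * x $ i)"
        unfolding q_def by (intro sum.mono_neutral_right) (auto simp: regression_row_outside)
      also have "\<dots> = ?R j j * x $ j + (\<Sum>i\<in>pa D j. ?R j i * x $ i)" by simp
      also have "(\<Sum>i\<in>pa D j. ?R j i * x $ i) = 0"
        using less by (intro sum.neutral) (auto simp: pa_def)
      finally show ?case using q0[of j] Rpos[of j] by simp
    qed
    with \<open>x \<noteq> 0\<close> show False by (simp add: vec_eq_iff)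
  qed
  then obtain j where "q j \<noteq> 0" by blast
  then have "0 < (q j)\<^sup>2 / ?R j j" using Rpos[of j] by simp
  then show "0 < x \<bullet> (dag_precision D \<Gamma> *v x)"
    unfolding quad using nonneg by (intro sum_pos2[of _ j]) auto
qed

text \<open>
  If \<open>S\<close> is the inverse of \<open>L\<^sup>T N L\<close>, then \<open>L S\<close> is the inverse of \<open>L\<^sup>T N\<close> and hence triangular with
  unit diagonal. So row \<open>j\<close> of \<open>L\<close> satisfies the same linear equations with \<open>S\<close> as with \<open>\<Gamma>\<close>, and the
  entries of both matrices agree at \<open>j\<close> once they agree on the parents of \<open>j\<close>.
\<close>

lemma matrix_inv_dag_precision:
  fixes D :: "'n::finite rel"
  assumes ac: "acyclic D" and pf: "perfect_dag D"
    and pd: "\<And>j. pos_def (principal (insert j (pa D j)) \<Gamma>)"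
    and b: "b \<in> insert j (pa D j)"
  shows "matrix_inv (dag_precision D \<Gamma>) $ j $ b = \<Gamma> $ j $ b"
proof -
  let ?R = "regression_row D \<Gamma>"
  define S where "S = matrix_inv (dag_precision D \<Gamma>)"
  define L :: "real^'n^'n" where "L = (\<chi> j k. ?R j k)"
  define N :: "real^'n^'n" where "N = (\<chi> i j. if i = j then 1 / ?R j j else 0)"
  note pdO = pos_def_dag_precision[OF ac pd]
  have Rpos: "0 < ?R j j" for j by (rule regression_row_diag_pos[OF pd])
  have wf: "wf D" using ac by (intro finite_acyclic_wf) simp_all
  have symS: "S $ i $ k = S $ k $ i" for i k
    unfolding S_def by (rule pos_def_sym[OF pos_def_matrix_inv[OF pdO]])
  define Y where "Y = L ** S"
  have "transpose L ** N ** L ** S = mat 1"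
    using matrix_inv_inverse(1)[OF pos_def_invertible[OF pdO]]
    unfolding S_def dag_precision_factor L_def N_def .
  then have "(transpose L ** N) ** Y = mat 1" by (simp add: Y_def matrix_mul_assoc)
  then have "Y ** (transpose L ** N) = mat 1" by (rule matrix_left_right_inverse1)
  then have YLN: "(Y ** (transpose L ** N)) $ j $ k = (if j = k then 1 else 0)" for j k
    by (simp add: mat_def)
  have YR: "(\<Sum>b\<in>insert k (pa D k). Y $ j $ b * ?R k b) = (if j = k then ?R k k else 0)" for j k
  proof -
    have "(Y ** (transpose L ** N)) $ j $ k = (\<Sum>b\<in>UNIV. Y $ j $ b * (?R k b / ?R k k))"
    proof -
      have "(transpose L ** N) $ b $ k = ?R k b / ?R k k" for b
        by (simp add: matrix_mult_entry N_def transpose_def L_def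
            if_distrib[of "\<lambda>x. _ * x"] cong: if_cong)
      then show ?thesis by (simp add: matrix_mult_entry[of Y])
    qed
    also have "\<dots> = (\<Sum>b\<in>UNIV. Y $ j $ b * ?R k b) / ?R k k" by (simp add: sum_divide_distrib)
    also have "(\<Sum>b\<in>UNIV. Y $ j $ b * ?R k b) = (\<Sum>b\<in>insert k (pa D k). Y $ j $ b * ?R k b)"
      by (intro sum.mono_neutral_right) (auto simp: regression_row_outside)
    finally show ?thesis using YLN[of j k] Rpos[of k] by (auto simp: field_simps split: if_splits)
  qed
  have Y: "Y $ j $ k = (if j = k then 1 else 0)" if "k \<in> insert j (nondesc D j)" for j k
    using wf that
  proof (induction k rule: wf_induct_rule)
    case (less k)
    have "Y $ j $ b = 0" if b: "b \<in> pa D k" for b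
    proof -
      have "b \<in> nondesc D j"
        using b less.prems family_subset_nondesc[OF ac, of k j] pa_subset_nondesc[OF ac, of j] by auto
      moreover have "(b, k) \<in> D" using b by (simp add: pa_def)
      ultimately show ?thesis using less.IH[of b] by (auto simp: nondesc_def)
    qed
    then have "Y $ j $ k * ?R k k = (if j = k then ?R k k else 0)" using YR[of j k] by simp
    then show ?case using Rpos[of k] by (auto split: if_splits)
  qed
  have S_eq: "(\<Sum>k\<in>insert j (pa D j). ?R j k * S $ k $ b) = (if j = b then 1 else 0)"
    if b: "b \<in> insert j (pa D j)" for j b
  proof -
    have "(\<Sum>k\<in>insert j (pa D j). ?R j k * S $ k $ b) = Y $ j $ b"
      unfolding Y_def matrix_mult_entry L_def vec_lambda_beta
      by (intro sum.mono_neutral_left) (auto simp: regression_row_outside)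
    then show ?thesis using Y[of b j] b pa_subset_nondesc[OF ac, of j] by auto
  qed
  have \<Gamma>_eq: "(\<Sum>k\<in>insert j (pa D j). ?R j k * \<Gamma> $ k $ b) = (if j = b then 1 else 0)"
    if b: "b \<in> insert j (pa D j)" for j b
    unfolding regression_row_def using b by (intro precision_mult pd) auto
  have sym\<Gamma>: "\<Gamma> $ i $ k = \<Gamma> $ k $ i" if "i \<in> insert j (pa D j)" "k \<in> insert j (pa D j)" for i j k
    using pd[of j] that unfolding pos_def_principal_iff by blast
  have "\<forall>b\<in>insert j (pa D j). S $ j $ b = \<Gamma> $ j $ b"
    using wf
  proof (induction j rule: wf_induct_rule)
    case (less j)
    have par: "S $ k $ b = \<Gamma> $ k $ b" if k: "k \<in> pa D j" and b: "b \<in> pa D j" for k b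
    proof -
      have kj: "(k, j) \<in> D" "(b, j) \<in> D" using k b by (auto simp: pa_def)
      have "{k, b} \<in> skeleton D" using family_complete[OF pf, of k j b] k b by simp
      then consider "k = b" | "b \<in> pa D k" | "k \<in> pa D b"
        unfolding skeleton_iff pa_iff[OF ac] by blast
      then show ?thesis
      proof cases
        case 3
        then have "S $ b $ k = \<Gamma> $ b $ k" using less.IH[OF kj(2)] by blast
        then show ?thesis using symS[of k b] sym\<Gamma>[of k j b] k b by simp
      qed (use less.IH[OF kj(1)] in auto)
    qed
    have jb: "S $ j $ b = \<Gamma> $ j $ b" if b: "b \<in> pa D j" for b
    proof -
      have "(\<Sum>k\<in>pa D j. ?R j k * S $ k $ b) = (\<Sum>k\<in>pa D j. ?R j k * \<Gamma> $ k $ b)"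
        using par b by simp
      then have "?R j j * S $ j $ b = ?R j j * \<Gamma> $ j $ b"
        using trans[OF S_eq[of b j] \<Gamma>_eq[of b j, symmetric]] b by simp
      then show ?thesis using Rpos[of j] by simp
    qed
    have "(\<Sum>k\<in>pa D j. ?R j k * S $ k $ j) = (\<Sum>k\<in>pa D j. ?R j k * \<Gamma> $ k $ j)"
    proof (rule sum.cong)
      fix k assume k: "k \<in> pa D j"
      show "?R j k * S $ k $ j = ?R j k * \<Gamma> $ k $ j"
        using jb[OF k] symS[of k j] sym\<Gamma>[of k j j] k by simp
    qed simp
    then have "?R j j * S $ j $ j = ?R j j * \<Gamma> $ j $ j"
      using trans[OF S_eq[of j j] \<Gamma>_eq[of j j, symmetric]] by simp
    then show ?case using jb Rpos[of j] by auto
  qed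
  then show ?thesis using b unfolding S_def by blast
qed

lemma complete_set_subset_clique:
  fixes E :: "'n::finite set set"
  assumes "complete_set E A"
  shows "\<exists>B\<in>cliques E. A \<subseteq> B"
proof -
  have "finite {B. complete_set E B}" by simp
  from finite_has_maximal2[OF this, of A] assms
  obtain B where B: "complete_set E B" "A \<subseteq> B" "\<And>B'. complete_set E B' \<Longrightarrow> B \<subseteq> B' \<Longrightarrow> B = B'"
    by auto
  then have "B \<in> cliques E" unfolding cliques_def by blast
  with B(2) show ?thesis by blast
qed

text \<open>
  Every vertex together with its parents is contained in a clique. Hence the regression rows of
  \<open>\<Gamma>\<close> are available and yield a completion; conversely they determine the inverse of any
  completion.
\<close>

theorem completion_in_PD_graph:
  fixes D :: "'n::finite rel"
  assumes ac: "acyclic D" and pf: "perfect_dag D" and \<Gamma>: "\<Gamma> \<in> Q_graph (skeleton D)"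
  shows "completion (skeleton D) \<Gamma> \<in> PD_graph (skeleton D)"
proof -
  let ?E = "skeleton D" and ?\<Omega> = "dag_precision D \<Gamma>"
  let ?S = "matrix_inv ?\<Omega>"
  have sym\<Gamma>: "\<Gamma> $ i $ j = \<Gamma> $ j $ i" for i j
  proof -
    have "transpose \<Gamma> $ j $ i = \<Gamma> $ j $ i" using \<Gamma> by (simp add: Q_graph_def)
    then show ?thesis by (simp add: transpose_def)
  qed
  have fam: "complete_set ?E (insert j (pa D j))" for j
    using family_complete[OF pf] unfolding complete_set_def by blast
  have pd: "pos_def (principal (insert j (pa D j)) \<Gamma>)" for j
  proof -
    obtain B where "B \<in> cliques ?E" "insert j (pa D j) \<subseteq> B"
      using complete_set_subset_clique[OF fam] by blast
    then show ?thesis using \<Gamma> pos_def_principal_subset unfolding Q_graph_def by blast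
  qed
  have pdO: "pos_def ?\<Omega>" by (rule pos_def_dag_precision[OF ac pd])
  then have "?\<Omega> \<in> P_graph ?E" using dag_precision_pattern[OF pf] unfolding P_graph_def by blast
  then have in_PD: "?S \<in> PD_graph ?E" unfolding PD_graph_def by blast
  have "?S $ i $ j = \<Gamma> $ i $ j" if ij: "{i, j} \<in> ?E" for i j
  proof -
    have "j \<in> insert i (pa D i) \<or> i \<in> insert j (pa D j)"
      using ij by (auto simp: skeleton_iff pa_iff[OF ac])
    then show ?thesis
      using matrix_inv_dag_precision[OF ac pf pd, of j i] matrix_inv_dag_precision[OF ac pf pd, of i j]
        sym\<Gamma>[of i j] pos_def_sym[OF pos_def_matrix_inv[OF pdO], of i j] by auto
  qed
  then have "incomplete ?E ?S = incomplete ?E \<Gamma>" by (simp add: incomplete_def vec_eq_iff)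
  then have inc: "incomplete ?E ?S = \<Gamma>" using \<Gamma> by (simp add: Q_graph_def)
  have "\<exists>!\<Sigma>. \<Sigma> \<in> PD_graph ?E \<and> incomplete ?E \<Sigma> = \<Gamma>"
  proof (rule ex1I[of _ ?S])
    show "?S \<in> PD_graph ?E \<and> incomplete ?E ?S = \<Gamma>" using in_PD inc by blast
    fix \<Sigma> assume \<Sigma>: "\<Sigma> \<in> PD_graph ?E \<and> incomplete ?E \<Sigma> = \<Gamma>"
    have "dag_precision D \<Sigma> = ?\<Omega>"
    proof (rule dag_precision_cong)
      fix j i k assume "i \<in> insert j (pa D j)" "k \<in> insert j (pa D j)"
      then have "{i, k} \<in> ?E" using family_complete[OF pf] by blast
      then have "incomplete ?E \<Sigma> $ i $ k = \<Sigma> $ i $ k" by (simp add: incomplete_def)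
      then show "\<Sigma> $ i $ k = \<Gamma> $ i $ k" using \<Sigma> by simp
    qed
    then have "matrix_inv \<Sigma> = ?\<Omega>" using PD_graph_matrix_inv(2)[OF ac pf] \<Sigma> by metis
    then show "\<Sigma> = ?S"
      using PD_graph_matrix_inv(1)[OF ac pf] \<Sigma> matrix_inv_matrix_inv pos_def_invertible by metis
  qed
  from theI'[OF this] show ?thesis unfolding completion_def by blast
qed

section \<open>The orientation belonging to a perfect order of the cliques\<close>

lemma det_principal_pa:
  assumes pd: "pos_def S"
  shows "det (principal (insert v (pa D v)) S) = det (principal (pa D v) S) * cond_var D S v"
    and "0 < cond_var D S v"
proof -
  let ?k = "precision (insert v (pa D v)) S $ v $ v"
  note pdv = pos_def_principal[OF pd, of "insert v (pa D v)"]
  have k: "?k * cond_var D S v = 1" by (rule cond_var_precision[OF pdv])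
  have kpos: "0 < ?k" by (rule precision_diag_pos[OF pdv]) simp
  show "0 < cond_var D S v" using k kpos by (metis zero_less_mult_pos zero_less_one)
  have "det (principal (pa D v) S) = ?k * det (principal (insert v (pa D v)) S)"
    by (rule det_principal_remove[OF pdv not_in_pa])
  then have "det (principal (pa D v) S) * cond_var D S v
      = (?k * cond_var D S v) * det (principal (insert v (pa D v)) S)" by simp
  then show "det (principal (insert v (pa D v)) S) = det (principal (pa D v) S) * cond_var D S v"
    unfolding k by simp
qed

text \<open>
  The chain rule for determinants, adding the vertices of \<open>W\<close> in the order given by \<open>idx\<close>.
\<close>

lemma det_principal_block:
  fixes S :: "real^'n::finite^'n" and idx :: "'n \<Rightarrow> nat"
  assumes pd: "pos_def S" and idx: "inj idx"
    and pa: "\<And>v. v \<in> W \<Longrightarrow> pa D v = A \<union> {u \<in> W. idx u < idx v}"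
  shows "det (principal (A \<union> W) S) = det (principal A S) * (\<Prod>v\<in>W. cond_var D S v)"
  using pa
proof (induction "card W" arbitrary: W)
  case 0
  then have "W = {}" by simp
  then show ?case by simp
next
  case (Suc n)
  then have ne: "W \<noteq> {}" by auto
  have "Max (idx ` W) \<in> idx ` W" using ne by (intro Max_in) auto
  then obtain v where v: "v \<in> W" "idx v = Max (idx ` W)" by (metis imageE)
  have max: "idx u \<le> idx v" if "u \<in> W" for u
    unfolding v(2) using that by (intro Max_ge) auto
  have lt: "idx u < idx v" if "u \<in> W" "u \<noteq> v" for u
    using max[OF that(1)] idx that(2) by (metis injD le_neq_implies_less)
  have pav: "pa D v = A \<union> (W - {v})" using Suc.prems[OF v(1)] lt by auto
  have ins: "insert v (pa D v) = A \<union> W" using pav v(1) by auto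
  have IH: "det (principal (A \<union> (W - {v})) S) = det (principal A S) * (\<Prod>v\<in>W - {v}. cond_var D S v)"
  proof (rule Suc.hyps(1))
    show "n = card (W - {v})" using Suc.hyps(2) v(1) by simp
    fix u assume u: "u \<in> W - {v}"
    then have "pa D u = A \<union> {w \<in> W. idx w < idx u}" using Suc.prems by simp
    moreover have "\<not> idx v < idx u" using u max by (simp add: not_less)
    ultimately show "pa D u = A \<union> {w \<in> W - {v}. idx w < idx u}" by auto
  qed
  have "det (principal (A \<union> W) S) = det (principal A S) * (\<Prod>v\<in>W - {v}. cond_var D S v) * cond_var D S v"
    using det_principal_pa(1)[OF pd, of v D] unfolding ins unfolding pav IH .
  then show ?case using v(1) by (simp add: prod.remove[of W v] mult_ac)
qed

locale perfectly_ordered_cliques =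
  fixes E :: "'n::finite set set" and r :: nat and C :: "nat \<Rightarrow> 'n set" and idx :: "'n \<Rightarrow> nat"
  assumes undirected: "undirected_graph E" and order: "perfect_order E r C"
    and two_cliques: "2 \<le> r" and idx: "inj idx"
begin

definition first_clique :: "'n \<Rightarrow> nat" where
  "first_clique v = (LEAST i. 1 \<le> i \<and> v \<in> C i)"

text \<open>
  The position of a vertex among the blocks \<open>S\<^sub>2\<close>, \<open>C\<^sub>1 - S\<^sub>2\<close>, \<open>R\<^sub>2\<close>, \<dots>, \<open>R\<^sub>r\<close>, numbered from \<open>0\<close>.
\<close>

definition level :: "'n \<Rightarrow> nat" where
  "level v = (if v \<in> separator C 2 then 0 else first_clique v)"

definition clique_dag :: "'n rel" where
  "clique_dag = {(i, j). {i, j} \<in> E \<and> (level i < level j \<or> level i = level j \<and> idx i < idx j)}"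

text \<open>
  The vertices of level \<open>m\<close> have the members of \<open>base m\<close> as common parents, and \<open>block m\<close> adds the
  vertices of level \<open>m\<close> to \<open>base m\<close>.
\<close>

definition base :: "nat \<Rightarrow> 'n set" where
  "base m = (if m = 0 then {} else if m = 1 then separator C 2 else separator C m)"

definition block :: "nat \<Rightarrow> 'n set" where
  "block m = (if m = 0 then separator C 2 else C m)"

lemma clique: "i \<in> {1..r} \<Longrightarrow> complete_set E (C i)"
  using order unfolding perfect_order_def bij_betw_def cliques_def by auto

lemma edge_in_clique:
  assumes "{u, v} \<in> E"
  shows "\<exists>i\<in>{1..r}. u \<in> C i \<and> v \<in> C i"
proof -
  have "complete_set E {u, v}"
    using assms undirected unfolding complete_set_def undirected_graph_def by (auto simp: insert_commute)
  then obtain B where "B \<in> cliques E" "{u, v} \<subseteq> B"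
    using complete_set_subset_clique by blast
  moreover have "C ` {1..r} = cliques E"
    using order by (simp add: perfect_order_def bij_betw_def)
  ultimately obtain i where "i \<in> {1..r}" "{u, v} \<subseteq> C i" by (metis imageE)
  then show ?thesis by auto
qed

lemma first_clique:
  shows "first_clique v \<in> {1..r}" and "v \<in> C (first_clique v)"
    and "1 \<le> i \<Longrightarrow> v \<in> C i \<Longrightarrow> first_clique v \<le> i"
proof -
  have "{v, v} \<in> E" using undirected by (simp add: undirected_graph_def)
  then obtain k where k: "k \<in> {1..r}" "v \<in> C k" using edge_in_clique by blast
  have "1 \<le> first_clique v \<and> v \<in> C (first_clique v)"
    unfolding first_clique_def by (rule LeastI[of _ k]) (use k in auto)
  moreover have least: "first_clique v \<le> k" if "1 \<le> k" "v \<in> C k" for k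
    unfolding first_clique_def by (rule Least_le) (use that in auto)
  moreover have "first_clique v \<le> r" using le_trans[OF least[of k]] k by simp
  ultimately show "first_clique v \<in> {1..r}" "v \<in> C (first_clique v)" by auto
  show "1 \<le> i \<Longrightarrow> v \<in> C i \<Longrightarrow> first_clique v \<le> i" by (rule least)
qed

lemma in_separator_iff:
  assumes "2 \<le> j"
  shows "v \<in> separator C j \<longleftrightarrow> v \<in> C j \<and> first_clique v < j"
proof
  assume "v \<in> separator C j"
  then obtain i where "i \<in> {1..j - 1}" "v \<in> C i" "v \<in> C j" by (auto simp: separator_def)
  then show "v \<in> C j \<and> first_clique v < j" using first_clique(3)[of i v] by auto
next
  assume v: "v \<in> C j \<and> first_clique v < j"
  then have "first_clique v \<in> {1..j - 1}" using first_clique(1)[of v] by auto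
  then show "v \<in> separator C j" using v first_clique(2)[of v] by (auto simp: separator_def)
qed

lemma separator_2: "separator C 2 = C 1 \<inter> C 2"
  by (auto simp: separator_def)

text \<open>
  Take the first clique \<open>C l\<close> that contains both vertices. If \<open>v\<close> occurred before it, then so would
  \<open>u\<close>, both would lie in the separator of \<open>C l\<close>, and this separator is contained in an earlier
  clique.
\<close>

lemma neighbour_in_first_clique:
  assumes uv: "{u, v} \<in> E" and le: "first_clique u \<le> first_clique v"
  shows "u \<in> C (first_clique v)"
proof -
  define l where "l = (LEAST l. l \<in> {1..r} \<and> u \<in> C l \<and> v \<in> C l)"
  obtain i where i: "i \<in> {1..r} \<and> u \<in> C i \<and> v \<in> C i" using edge_in_clique[OF uv] by blast
  then have l: "l \<in> {1..r}" "u \<in> C l" "v \<in> C l"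
    unfolding l_def using LeastI[of "\<lambda>l. l \<in> {1..r} \<and> u \<in> C l \<and> v \<in> C l" i] by auto
  have "l \<le> first_clique v"
  proof (rule ccontr)
    assume "\<not> l \<le> first_clique v"
    then have gt: "first_clique v < l" "first_clique u < l" using le by auto
    then have l2: "2 \<le> l" using first_clique(1)[of v] by auto
    obtain k where k: "k \<in> {1..<l}" "separator C l \<subseteq> C k"
    proof -
      have "\<forall>j\<in>{2..r}. \<exists>i\<in>{1..<j}. separator C j \<subseteq> C i"
        using order by (simp add: perfect_order_def)
      moreover have "l \<in> {2..r}" using l(1) l2 by simp
      ultimately show ?thesis using that by blast
    qed
    have "u \<in> separator C l" "v \<in> separator C l" using gt l by (simp_all add: in_separator_iff[OF l2])
    then have "k \<in> {1..r} \<and> u \<in> C k \<and> v \<in> C k" using k l by auto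
    then have "l \<le> k" unfolding l_def by (rule Least_le)
    then show False using k by auto
  qed
  moreover have "first_clique v \<le> l" using l by (intro first_clique(3)) auto
  ultimately show ?thesis using l by simp
qed

lemma level_le: "level v \<le> r"
  using first_clique(1)[of v] by (simp add: level_def)

lemma first_clique_eq_max_level: "first_clique v = max 1 (level v)"
proof (cases "v \<in> separator C 2")
  case True
  then have "first_clique v \<le> 1" by (intro first_clique(3)) (auto simp: separator_2)
  then show ?thesis using True first_clique(1)[of v] by (simp add: level_def)
next
  case False
  then show ?thesis using first_clique(1)[of v] by (auto simp: level_def)
qed

lemma level_eq_0_iff: "level v = 0 \<longleftrightarrow> v \<in> separator C 2"
proof -
  have "first_clique v \<noteq> 0" using first_clique(1)[of v] by simp
  then show ?thesis by (simp add: level_def)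
qed

lemma block_complete:
  assumes "m \<le> r"
  shows "complete_set E (block m)"
proof (cases "m = 0")
  case True
  have "complete_set E (C 1)" using two_cliques by (intro clique) simp
  then show ?thesis using True by (auto simp: block_def separator_2 complete_set_def)
next
  case False
  then show ?thesis using assms by (auto simp: block_def intro!: clique)
qed

lemma in_base_iff:
  assumes "m \<le> r"
  shows "u \<in> base m \<longleftrightarrow> u \<in> block m \<and> level u < m"
proof -
  consider "m = 0" | "m = 1" | "2 \<le> m" by linarith
  then show ?thesis
  proof cases
    case 2
    then show ?thesis using level_eq_0_iff[of u] by (auto simp: base_def block_def separator_2)
  next
    case 3
    then show ?thesis
      using in_separator_iff[OF 3, of u] first_clique_eq_max_level[of u] by (auto simp: base_def block_def)
  qed (simp add: base_def)
qed

lemma level_in_block: "v \<in> block (level v)"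
  using first_clique(2)[of v] level_eq_0_iff[of v] first_clique_eq_max_level[of v]
  by (auto simp: block_def)

lemma level_le_block:
  assumes "u \<in> block m" and "m \<le> r"
  shows "level u \<le> m"
proof (cases "m = 0")
  case True
  then show ?thesis using assms level_eq_0_iff[of u] by (simp add: block_def)
next
  case False
  then show ?thesis
    using assms first_clique(3)[of m u] first_clique_eq_max_level[of u] by (simp add: block_def)
qed

lemma block_eq:
  assumes "m \<le> r"
  shows "block m = base m \<union> {v. level v = m}"
  using in_base_iff[OF assms] level_le_block[OF _ assms] level_in_block by fastforce

lemma earlier_neighbour_in_block:
  assumes uv: "{u, v} \<in> E" and le: "level u \<le> level v"
  shows "u \<in> block (level v)"
proof (cases "level v = 0")
  case True
  then have "level u = 0" using le by simp
  then show ?thesis using True level_eq_0_iff[of u] by (simp add: block_def)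
next
  case False
  then have fv: "first_clique v = level v" by (simp add: first_clique_eq_max_level)
  have "first_clique u \<le> first_clique v" using le by (simp add: first_clique_eq_max_level)
  then show ?thesis using neighbour_in_first_clique[OF uv] False fv by (simp add: block_def)
qed

lemma acyclic_clique_dag: "acyclic clique_dag"
proof -
  have "clique_dag \<subseteq> inv_image (less_than <*lex*> less_than) (\<lambda>v. (level v, idx v))"
    by (auto simp: clique_dag_def)
  moreover have "wf (inv_image (less_than <*lex*> less_than) (\<lambda>v. (level v, idx v)))"
    by (intro wf_inv_image wf_lex_prod wf_less_than)
  ultimately show ?thesis using wf_acyclic wf_subset by blast
qed

lemma pa_clique_dag:
  assumes m: "level v = m"
  shows "pa clique_dag v = base m \<union> {u \<in> {u. level u = m}. idx u < idx v}"
proof (intro set_eqI iffI)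
  have mr: "m \<le> r" using level_le[of v] m by simp
  fix u
  {
    assume "u \<in> pa clique_dag v"
    then have uv: "{u, v} \<in> E" "level u < level v \<or> level u = level v \<and> idx u < idx v"
      by (auto simp: pa_def clique_dag_def)
    then have "u \<in> block m" using earlier_neighbour_in_block m by fastforce
    then show "u \<in> base m \<union> {u \<in> {u. level u = m}. idx u < idx v}"
      using uv m by (auto simp: in_base_iff[OF mr])
  next
    assume u: "u \<in> base m \<union> {u \<in> {u. level u = m}. idx u < idx v}"
    then have lt: "level u < level v \<or> level u = level v \<and> idx u < idx v"
      using m in_base_iff[OF mr] by auto
    have "u \<in> block m" "v \<in> block m" using u m by (auto simp: block_eq[OF mr])
    then have "{u, v} \<in> E" using block_complete[OF mr] unfolding complete_set_def by blast
    then show "u \<in> pa clique_dag v" using lt by (auto simp: pa_def clique_dag_def)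
  }
qed

lemma skeleton_clique_dag: "skeleton clique_dag = E"
proof (intro set_eqI iffI)
  fix e assume "e \<in> skeleton clique_dag"
  then show "e \<in> E"
    using undirected by (auto simp: skeleton_def clique_dag_def undirected_graph_def)
next
  fix e assume e: "e \<in> E"
  then obtain i j where ij: "e = {i, j}" using undirected by (auto simp: undirected_graph_def)
  have "idx i \<noteq> idx j" if "i \<noteq> j" using idx that by (auto dest: injD)
  then have "i = j \<or> (i, j) \<in> clique_dag \<or> (j, i) \<in> clique_dag"
    using e ij by (auto simp: clique_dag_def insert_commute)
  then show "e \<in> skeleton clique_dag" unfolding ij skeleton_iff .
qed

lemma perfect_clique_dag: "perfect_dag clique_dag"
  unfolding perfect_dag_def
proof (intro allI ballI impI)
  fix j i k assume i: "i \<in> pa clique_dag j" and k: "k \<in> pa clique_dag j" and ne: "i \<noteq> k"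
  have "i \<in> block (level j)" "k \<in> block (level j)"
    using i k unfolding pa_clique_dag[OF refl] block_eq[OF level_le] by auto
  then have "{i, k} \<in> E" using block_complete[OF level_le] unfolding complete_set_def by blast
  then show "(i, k) \<in> clique_dag \<or> (k, i) \<in> clique_dag"
    using ne skeleton_iff[of i k clique_dag] unfolding skeleton_clique_dag by blast
qed

lemma card_base_le_pa: "card (base (level v)) \<le> card (pa clique_dag v)"
  unfolding pa_clique_dag[OF refl] by (intro card_mono) auto

lemma det_block:
  assumes pd: "pos_def S" and m: "m \<le> r"
  shows "det (principal (block m) S) =
    det (principal (base m) S) * (\<Prod>v | level v = m. cond_var clique_dag S v)"
  unfolding block_eq[OF m] by (rule det_principal_block[OF pd idx]) (use pa_clique_dag in auto)

text \<open>
  The exponential form turns the regrouping of determinants into a regrouping of sums.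
\<close>

lemma markov_ratio_exp:
  assumes pd: "pos_def S"
  shows "markov_ratio r C a b (incomplete E S) =
    exp ((\<Sum>i\<in>{1..r}. a i * ln (det (principal (C i) S)))
      - (\<Sum>i\<in>{2..r}. b i * ln (det (principal (separator C i) S))))"
proof -
  have inc: "principal A (incomplete E S) = principal A S" if "complete_set E A" for A
    using that by (intro principal_cong) (auto simp: incomplete_def complete_set_def)
  have C: "principal (C i) (incomplete E S) = principal (C i) S" if "i \<in> {1..r}" for i
    using that by (intro inc clique)
  have sep: "principal (separator C i) (incomplete E S) = principal (separator C i) S" if "i \<in> {2..r}" for i
  proof -
    have "complete_set E (C i)" using that by (intro clique) auto
    then show ?thesis by (intro inc) (auto simp: separator_def complete_set_def)
  qed
  have pos: "0 < det (principal A S)" for A by (rule det_principal_pos[OF pos_def_principal[OF pd]])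
  have powr: "det (principal A S) powr e = exp (e * ln (det (principal A S)))" for A e
    using pos[of A] by (simp add: powr_def)
  show ?thesis unfolding markov_ratio_def by (simp add: C sep powr exp_diff exp_sum)
qed

text \<open>
  By the chain rule, the logarithms of the conditional variances at level \<open>m\<close> add up to
  \<open>ln (det S\<^sub>B) - ln (det S\<^sub>A)\<close> for \<open>B = block m\<close> and \<open>A = base m\<close>. Comparing with the Markov ratio,
  each separator remains with the exponent \<open>\<Sum> (a j - b j)\<close>, which is balanced by assumption except
  for the separator \<open>separator C 2\<close>, whose exponent goes to the vertices of level \<open>0\<close>.
\<close>

lemma markov_ratio_cond_var:
  assumes pd: "pos_def S"
    and bal: "\<And>T. T \<in> separator C ` {2..r} \<Longrightarrow> T \<noteq> separator C 2 \<Longrightarrow>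
      (\<Sum>j\<in>sep_indices r C T. a j - b j) = 0"
    and e: "e = (\<Sum>j\<in>sep_indices r C (separator C 2). a j - b j)"
  shows "markov_ratio r C a b (incomplete E S) =
    (\<Prod>v\<in>UNIV. cond_var clique_dag S v powr (if level v = 0 then a 1 + e else a (level v)))"
proof -
  let ?l = "\<lambda>A. ln (det (principal A S))" and ?cv = "cond_var clique_dag S"
  let ?g = "\<lambda>m. if m = 0 then a 1 + e else a m"
  have cv: "0 < ?cv v" for v by (rule det_principal_pa(2)[OF pd])
  have pos: "0 < det (principal A S)" for A by (rule det_principal_pos[OF pos_def_principal[OF pd]])
  have lev: "(\<Sum>v | level v = m. ln (?cv v)) = ?l (block m) - ?l (base m)" if "m \<le> r" for m
  proof -
    have "?l (block m) = ?l (base m) + ln (\<Prod>v | level v = m. ?cv v)"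
      unfolding det_block[OF pd that] using pos cv by (intro ln_mult_pos) (auto intro!: prod_pos)
    also have "ln (\<Prod>v | level v = m. ?cv v) = (\<Sum>v | level v = m. ln (?cv v))"
      by (intro ln_prod) (simp_all add: cv less_imp_neq[OF cv, symmetric])
    finally show ?thesis by simp
  qed
  have "(\<Prod>v\<in>UNIV. ?cv v powr ?g (level v)) = exp (\<Sum>v\<in>UNIV. ?g (level v) * ln (?cv v))"
  proof -
    have "?cv v powr x = exp (x * ln (?cv v))" for v x using cv[of v] by (simp add: powr_def)
    then show ?thesis by (simp add: exp_sum)
  qed
  also have "(\<Sum>v\<in>UNIV. ?g (level v) * ln (?cv v))
      = (\<Sum>m\<in>{0..r}. \<Sum>v | v \<in> UNIV \<and> level v = m. ?g (level v) * ln (?cv v))"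
    by (rule sum.group[symmetric]) (use level_le in auto)
  also have "\<dots> = (\<Sum>m\<in>{0..r}. ?g m * (?l (block m) - ?l (base m)))"
  proof (rule sum.cong)
    fix m assume "m \<in> {0..r}"
    then have "?g m * (?l (block m) - ?l (base m)) = (\<Sum>v | level v = m. ?g m * ln (?cv v))"
      by (simp add: lev[symmetric] sum_distrib_left)
    then show "(\<Sum>v | v \<in> UNIV \<and> level v = m. ?g (level v) * ln (?cv v))
        = ?g m * (?l (block m) - ?l (base m))" by simp
  qed simp
  also have "{0..r} = insert 0 (insert 1 {2..r})" using two_cliques by auto
  also have "(\<Sum>m\<in>insert 0 (insert 1 {2..r}). ?g m * (?l (block m) - ?l (base m)))
      = (a 1 + e) * ?l (separator C 2) + (a 1 * (?l (C 1) - ?l (separator C 2))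
        + (\<Sum>m\<in>{2..r}. a m * (?l (C m) - ?l (separator C m))))"
  proof -
    have "(\<Sum>m\<in>{2..r}. ?g m * (?l (block m) - ?l (base m)))
        = (\<Sum>m\<in>{2..r}. a m * (?l (C m) - ?l (separator C m)))"
      by (intro sum.cong) (auto simp: block_def base_def)
    then show ?thesis by (simp add: block_def base_def)
  qed
  also have "\<dots> = (\<Sum>m\<in>{1..r}. a m * ?l (C m)) - (\<Sum>m\<in>{2..r}. b m * ?l (separator C m))"
  proof -
    have "(\<Sum>m\<in>{2..r}. (a m - b m) * ?l (separator C m))
        = (\<Sum>T\<in>separator C ` {2..r}. \<Sum>m | m \<in> {2..r} \<and> separator C m = T. (a m - b m) * ?l (separator C m))"
      by (rule sum.image_gen) simp
    also have "\<dots> = (\<Sum>T\<in>separator C ` {2..r}. (\<Sum>m\<in>sep_indices r C T. a m - b m) * ?l T)"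
      by (intro sum.cong) (auto simp: sep_indices_def sum_distrib_right)
    also have "\<dots> = (\<Sum>T\<in>{separator C 2}. (\<Sum>m\<in>sep_indices r C T. a m - b m) * ?l T)"
      using two_cliques bal by (intro sum.mono_neutral_right) auto
    also have "\<dots> = e * ?l (separator C 2)" by (simp add: e)
    finally have "(\<Sum>m\<in>{2..r}. a m * ?l (separator C m)) = (\<Sum>m\<in>{2..r}. b m * ?l (separator C m))
        + e * ?l (separator C 2)" by (simp add: algebra_simps sum_subtractf)
    moreover have "{1..r} = insert 1 {2..r}" using two_cliques by auto
    ultimately show ?thesis by (simp add: algebra_simps sum_subtractf)
  qed
  finally show ?thesis by (simp add: markov_ratio_exp[OF pd])
qed

end

section \<open>Equality of the two Wishart families\<close>

lemma measurable_det:
  fixes F :: "'a \<Rightarrow> real^'n::finite^'n"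
  assumes "\<And>i j. (\<lambda>x. F x $ i $ j) \<in> borel_measurable M"
  shows "(\<lambda>x. det (F x)) \<in> borel_measurable M"
  unfolding det_def by (intro borel_measurable_sum borel_measurable_times borel_measurable_prod
      borel_measurable_const assms)

lemma measurable_matrix_entry: "(\<lambda>A :: real^'n::finite^'m::finite. A $ i $ j) \<in> borel_measurable borel"
  by (intro borel_measurable_continuous_onI continuous_intros)

lemma matrix_inv_cramer:
  fixes A :: "real^'n::finite^'n"
  assumes "invertible A"
  shows "matrix_inv A $ i $ j =
    det (\<chi> k l. if l = i then (if k = j then 1 else 0) else A $ k $ l) / det A"
proof -
  define b :: "real^'n" where "b = (\<chi> k. if k = j then 1 else 0)"
  have "A *v (matrix_inv A *v b) = b"
    by (simp add: matrix_vector_mul_assoc matrix_inv_inverse assms)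
  then have "matrix_inv A *v b = (\<chi> k. det (\<chi> i l. if l = k then b $ i else A $ i $ l) / det A)"
    using assms by (subst cramer[symmetric]) (simp_all add: invertible_det_nz)
  then have "(matrix_inv A *v b) $ i = det (\<chi> k l. if l = i then b $ k else A $ k $ l) / det A"
    by simp
  moreover have "(matrix_inv A *v b) $ i = matrix_inv A $ i $ j"
    by (simp add: matrix_vector_mult_def b_def if_distrib[of "\<lambda>x. _ * x"] cong: if_cong)
  ultimately show ?thesis by (simp add: b_def cong: if_cong)
qed

text \<open>
  On positive definite matrices, Cramer's rule replaces \<open>matrix_inv\<close> by a quotient of polynomials.
\<close>

lemma measurable_markov_ratio:
  "(\<lambda>\<Omega>. markov_ratio r C a b (incomplete E (matrix_inv \<Omega>)))
    \<in> borel_measurable (restrict_space (sym_lebesgue E) (P_graph E))"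
proof -
  let ?M = "restrict_space (sym_lebesgue E) (P_graph E)"
  define J :: "real^'a^'a \<Rightarrow> real^'a^'a" where
    "J \<Omega> = (\<chi> i j. det (\<chi> k l. if l = i then (if k = j then 1 else 0) else \<Omega> $ k $ l) / det \<Omega>)" for \<Omega>
  have entry: "(\<lambda>\<Omega> :: real^'a^'a. \<Omega> $ i $ j) \<in> borel_measurable ?M" for i j
    using measurable_matrix_entry[of i j]
    by (intro measurable_restrict_space1) (simp add: measurable_def sym_lebesgue_def)
  have J: "matrix_inv \<Omega> = J \<Omega>" if "\<Omega> \<in> space ?M" for \<Omega>
  proof -
    have "pos_def \<Omega>" using that by (simp add: space_restrict_space P_graph_def)
    then show ?thesis by (simp add: vec_eq_iff J_def matrix_inv_cramer pos_def_invertible)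
  qed
  have meas_J: "(\<lambda>\<Omega>. J \<Omega> $ i $ j) \<in> borel_measurable ?M" for i j
  proof -
    have "(\<lambda>\<Omega>. (\<chi> k l. if l = i then (if k = j then 1 else 0) else \<Omega> $ k $ l) $ k $ l)
        \<in> borel_measurable ?M" for k l
      using entry[of k l] by (cases "l = i") simp_all
    then show ?thesis
      unfolding J_def vec_lambda_beta by (intro borel_measurable_divide measurable_det) (auto simp: entry)
  qed
  have meas_principal: "(\<lambda>\<Omega>. principal A (incomplete E (J \<Omega>)) $ i $ j) \<in> borel_measurable ?M" for A i j
    using meas_J[of i j]
    by (cases "i \<in> A \<and> j \<in> A"; cases "{i, j} \<in> E") (auto simp: principal_def incomplete_def)
  have "(\<lambda>\<Omega>. markov_ratio r C a b (incomplete E (J \<Omega>))) \<in> borel_measurable ?M"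
    unfolding markov_ratio_def
    by (intro borel_measurable_divide borel_measurable_prod powr_real_measurable
        measurable_det meas_principal borel_measurable_const)
  then show ?thesis using J by (subst measurable_cong[where g = "\<lambda>\<Omega>. markov_ratio r C a b (incomplete E (J \<Omega>))"]) auto
qed

lemma measurable_exp_trace:
  "(\<lambda>\<Omega>. exp (- trace (\<Omega> ** U))) \<in> borel_measurable (restrict_space (sym_lebesgue E) A)"
proof -
  have entry: "(\<lambda>\<Omega> :: real^'a^'a. \<Omega> $ i $ j) \<in> borel_measurable (restrict_space (sym_lebesgue E) A)" for i j
    using measurable_matrix_entry[of i j]
    by (intro measurable_restrict_space1) (simp add: measurable_def sym_lebesgue_def)
  show ?thesis
    unfolding trace_def matrix_matrix_mult_def vec_lambda_beta
    by (intro measurable_compose[OF _ borel_measurable_exp] borel_measurable_uminus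
        borel_measurable_sum borel_measurable_times entry borel_measurable_const)
qed

context perfectly_ordered_cliques
begin

lemma markov_ratio_mult:
  assumes "pos_def S"
  shows "markov_ratio r C a b (incomplete E S) * markov_ratio r C a' b' (incomplete E S) =
    markov_ratio r C (\<lambda>j. a j + a' j) (\<lambda>j. b j + b' j) (incomplete E S)"
  unfolding markov_ratio_exp[OF assms] exp_add[symmetric]
  by (simp add: algebra_simps sum.distrib)

lemma typeII_wishart_eq_dag_wishart:
  assumes bal: "\<And>T. T \<in> separator C ` {2..r} \<Longrightarrow> T \<noteq> separator C 2 \<Longrightarrow>
      (\<Sum>j\<in>sep_indices r C T. \<alpha> j + (real (card (C j)) - real (card (separator C j))) / 2)
      - (\<Sum>j\<in>sep_indices r C T. \<beta> j) = 0"
    and \<gamma>: "\<And>v. \<gamma> $ v = (if level v = 0 then \<alpha> 1 + (real (card (C 1)) + 1) / 2 + eta2 r C \<alpha> \<beta>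
      else \<alpha> (level v) + (real (card (C (level v))) + 1) / 2)"
  shows "typeII_wishart E r C \<alpha> \<beta> \<Gamma> = dag_wishart clique_dag \<gamma> (completion E \<Gamma>)"
proof -
  let ?M = "restrict_space (sym_lebesgue E) (P_graph E)" and ?U = "completion E \<Gamma>"
  let ?ca = "\<lambda>j. (real (card (C j)) + 1) / 2" and ?cb = "\<lambda>j. (real (card (separator C j)) + 1) / 2"
  let ?a = "\<lambda>j. \<alpha> j + ?ca j" and ?b = "\<lambda>j. \<beta> j + ?cb j"
  define f where "f \<Omega> = ennreal (markov_ratio r C ?ca ?cb (incomplete E (matrix_inv \<Omega>)))" for \<Omega>
  define g where "g \<Omega> = ennreal (exp (- trace (\<Omega> ** ?U)) *
    markov_ratio r C \<alpha> \<beta> (incomplete E (matrix_inv \<Omega>)))" for \<Omega>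
  define h where "h \<Omega> = ennreal (exp (- trace (\<Omega> ** ?U)) *
    (\<Prod>j\<in>UNIV. cond_var clique_dag (matrix_inv \<Omega>) j powr (\<gamma> $ j)))" for \<Omega>
  have [measurable]: "f \<in> borel_measurable ?M" "g \<in> borel_measurable ?M"
    unfolding f_def g_def
    by (intro measurable_compose[OF _ measurable_ennreal] borel_measurable_times
        measurable_markov_ratio measurable_exp_trace)+
  have diff: "(\<Sum>j\<in>sep_indices r C T. ?a j - ?b j) =
      (\<Sum>j\<in>sep_indices r C T. \<alpha> j + (real (card (C j)) - real (card (separator C j))) / 2)
      - (\<Sum>j\<in>sep_indices r C T. \<beta> j)" for T
    unfolding sum_subtractf[symmetric] by (intro sum.cong) (auto simp: field_simps)
  have fgh: "f \<Omega> * g \<Omega> = h \<Omega>" if "\<Omega> \<in> space ?M" for \<Omega>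
  proof -
    define S where "S = matrix_inv \<Omega>"
    have "pos_def \<Omega>" using that by (simp add: space_restrict_space P_graph_def)
    then have S: "pos_def S" unfolding S_def by (rule pos_def_matrix_inv)
    have "eta2 r C \<alpha> \<beta> = (\<Sum>j\<in>sep_indices r C (separator C 2). ?a j - ?b j)"
      unfolding eta2_def diff by (intro arg_cong2[where f = minus] sum.cong) (auto simp: sep_indices_def)
    then have "markov_ratio r C ?a ?b (incomplete E S) = (\<Prod>v\<in>UNIV. cond_var clique_dag S v powr
        (if level v = 0 then ?a 1 + eta2 r C \<alpha> \<beta> else ?a (level v)))"
      by (intro markov_ratio_cond_var[OF S]) (simp_all only: diff bal not_False_eq_True)
    also have "\<dots> = (\<Prod>v\<in>UNIV. cond_var clique_dag S v powr (\<gamma> $ v))"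
      by (simp add: \<gamma>)
    finally have MR: "markov_ratio r C \<alpha> \<beta> (incomplete E S) * markov_ratio r C ?ca ?cb (incomplete E S)
        = (\<Prod>v\<in>UNIV. cond_var clique_dag S v powr (\<gamma> $ v))"
      by (simp only: markov_ratio_mult[OF S])
    have "0 \<le> markov_ratio r C ?ca ?cb (incomplete E S)" by (simp add: markov_ratio_exp[OF S])
    then show ?thesis
      unfolding f_def g_def h_def S_def[symmetric] MR[symmetric]
      by (simp add: ennreal_mult''[symmetric] mult_ac)
  qed
  have "(\<lambda>\<Omega>. f \<Omega> * g \<Omega>) \<in> borel_measurable ?M" by simp
  moreover from this have "h \<in> borel_measurable ?M"
    using fgh by (subst measurable_cong[where g = "\<lambda>\<Omega>. f \<Omega> * g \<Omega>"]) auto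
  ultimately have "density ?M (\<lambda>\<Omega>. f \<Omega> * g \<Omega>) = density ?M h"
    by (rule density_cong) (simp add: fgh)
  then have "density (density ?M f) g = density ?M h" by (simp add: density_density_eq)
  then show ?thesis
    unfolding typeII_wishart_def typeII_unnormalized_def nu_graph_def dag_wishart_def
      skeleton_clique_dag P_dag_eq_P_graph[OF acyclic_clique_dag perfect_clique_dag]
      f_def g_def h_def by simp
qed

text \<open>
  Already the number \<open>card (base (level v))\<close> of common parents suffices; at the first vertex of each
  block it is the exact number of parents.
\<close>

lemma shape_bound:
  assumes "(\<alpha>, \<beta>) \<in> B_order r C"
  shows "(if level v = 0 then \<alpha> 1 + (real (card (C 1)) + 1) / 2 + eta2 r C \<alpha> \<beta>
      else \<alpha> (level v) + (real (card (C (level v))) + 1) / 2) < real (card (pa clique_dag v)) / 2 + 1"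
proof -
  have B: "\<And>j. j \<in> {2..r} \<Longrightarrow> - \<alpha> j - (real (card (C j)) - real (card (separator C j)) - 1) / 2 > 0"
    "- \<alpha> 1 - (real (card (C 1)) - real (card (separator C 2)) - 1) / 2 > 0"
    "- \<alpha> 1 - (real (card (C 1)) - real (card (separator C 2))) / 2 - eta2 r C \<alpha> \<beta>
       > (real (card (separator C 2)) - 1) / 2"
    using assms unfolding B_order_def by auto
  have "(if level v = 0 then \<alpha> 1 + (real (card (C 1)) + 1) / 2 + eta2 r C \<alpha> \<beta>
      else \<alpha> (level v) + (real (card (C (level v))) + 1) / 2) < real (card (base (level v))) / 2 + 1"
  proof -
    consider "level v = 0" | "level v = 1" | "level v \<in> {2..r}" using level_le[of v] by fastforce
    then show ?thesis
    proof cases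
      case 3
      then show ?thesis using B(1)[OF 3] by (auto simp: base_def field_simps)
    qed (use B(2,3) in \<open>auto simp: base_def field_simps\<close>)
  qed
  then show ?thesis using card_base_le_pa[of v] by simp
qed

end

theorem theorem5p1:
  fixes E :: "'n::finite set set" and r :: nat and C :: "nat \<Rightarrow> 'n set"
  assumes "undirected_graph E" and "chordal E" and "\<not> complete_set E UNIV"
    and "perfect_order E r C"
  shows "\<exists>D. dag_version D E \<and> perfect_dag D \<and>
    (\<forall>(\<alpha>, \<beta>)\<in>B_order r C. \<forall>\<Gamma>\<in>Q_graph E.
       \<exists>(\<gamma> :: real^'n) (U :: real^'n^'n).
         (\<forall>j. \<gamma> $ j < real (card (pa D j)) / 2 + 1) \<and> pos_def U \<and>
         typeII_wishart E r C \<alpha> \<beta> \<Gamma> = dag_wishart D \<gamma> U)"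
proof -
  \<comment> \<open>A single clique would contain every vertex, and the graph would be complete.\<close>
  have "2 \<le> r"
  proof (rule ccontr)
    assume "\<not> 2 \<le> r"
    then have "{1..r} \<subseteq> {1}" by auto
    then have cl: "cliques E \<subseteq> {C 1}"
      using assms(4) unfolding perfect_order_def bij_betw_def by blast
    have "v \<in> C 1" for v
    proof -
      have "complete_set E {v}" using assms(1) by (simp add: complete_set_def undirected_graph_def)
      then show ?thesis using complete_set_subset_clique cl by blast
    qed
    then have C1: "C 1 = UNIV" by auto
    have "complete_set E {}" by (simp add: complete_set_def)
    then have "C 1 \<in> cliques E" using complete_set_subset_clique cl by blast
    then show False using assms(3) C1 by (simp add: cliques_def)
  qed
  obtain idx :: "'n \<Rightarrow> nat" where "inj idx"
    using finite_imp_inj_to_nat_seg[OF finite] by blast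
  interpret perfectly_ordered_cliques E r C idx
    by unfold_locales fact+
  have "\<exists>(\<gamma> :: real^'n) (U :: real^'n^'n).
      (\<forall>j. \<gamma> $ j < real (card (pa clique_dag j)) / 2 + 1) \<and> pos_def U \<and>
      typeII_wishart E r C \<alpha> \<beta> \<Gamma> = dag_wishart clique_dag \<gamma> U"
    if B: "(\<alpha>, \<beta>) \<in> B_order r C" and \<Gamma>: "\<Gamma> \<in> Q_graph E" for \<alpha> \<beta> \<Gamma>
  proof -
    define \<gamma> :: "real^'n" where
      "\<gamma> = (\<chi> v. if level v = 0 then \<alpha> 1 + (real (card (C 1)) + 1) / 2 + eta2 r C \<alpha> \<beta>
        else \<alpha> (level v) + (real (card (C (level v))) + 1) / 2)"
    have "pos_def (completion E \<Gamma>)"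
      using completion_in_PD_graph[OF acyclic_clique_dag perfect_clique_dag] \<Gamma>
        PD_graph_matrix_inv(1)[OF acyclic_clique_dag perfect_clique_dag]
      unfolding skeleton_clique_dag by blast
    moreover have "\<gamma> $ j < real (card (pa clique_dag j)) / 2 + 1" for j
      using shape_bound[OF B, of j] by (simp add: \<gamma>_def)
    moreover have "typeII_wishart E r C \<alpha> \<beta> \<Gamma> = dag_wishart clique_dag \<gamma> (completion E \<Gamma>)"
      by (rule typeII_wishart_eq_dag_wishart) (use B in \<open>auto simp: B_order_def \<gamma>_def\<close>)
    ultimately show ?thesis by blast
  qed
  then show ?thesis
    using acyclic_clique_dag perfect_clique_dag skeleton_clique_dag unfolding dag_version_def by blast
qed

end
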